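(* Let $\mu$ be a positive rational number. Then $\Sigma_\mu$, with the topology $\mathcal{T}$, is a bundled analytic manifold.
   Context: Matrices are over $\mathbb{R}$. Write $\mu=\mu_y/\mu_x$ with $\mu_y,\mu_x$ coprime positive integers, $\mathcal{M}_\mu^i:=\mathcal{M}_{i\mu_y\times i\mu_x}\cong\mathbb{R}^{i^2\mu_y\mu_x}$, $\mathcal{M}_\mu:=\bigcup_{i\ge1}\mathcal{M}_\mu^i$. $A\sim B$ means $A\otimes I_s=B\otimes I_t$ (Kronecker product) for some positive integers $s,t$; $\Sigma_\mu:=\mathcal{M}_\mu/\!\sim$ with classes $\langle A\rangle$. For a nonempty open $o_i\subset\mathcal{M}_\mu^i$ put $s_i(o_i):=\{\langle A\rangle\in\Sigma_\mu:\langle A\rangle\cap o_i\neq\emptyset\}$; $\mathcal{T}$ is the topology generated by the sub-basis of all $s_i(o_i)$, $i\ge 1$, with $o_i$ an open ball in $\mathcal{M}_\mu^i$ with rational center and rational radius. Bundled manifolds. Let $M$ be a topological space. A nonempty open set $U\subset M$ is a simple coordinate chart of dimension $s$ if there is a homeomorphism $\phi:U\to\Theta$ onto an open set $\Theta\subset\mathbb{R}^s$. A nonempty open set $U$ is a bundled coordinate chart if $U=\bigcap_{i=1}^kU_i$ for finitely many simple coordinate charts $U_i$ with homeomorphisms $\phi_i:U_i\to\Theta_i\subset\mathbb{R}^{s_i}$ (the dimensions $s_i$ may be assumed distinct). Two bundled coordinate charts $U=\bigcap_{i=1}^{k_1}U_i$ and $V=\bigcap_{j=1}^{k_2}V_j$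 are $C^r$ comparable ($r$ may be $\infty$, or $\omega$ for analytic) if, whenever $U_i$ and $V_j$ have equal dimension, they are $C^r$ comparable in the usual sense, i.e. both transition maps between $\phi_i(U_i\cap V_j)$ and $\psi_j(U_i\cap V_j)$ are $C^r$. $M$ is a bundled $C^r$ manifold (bundled analytic manifold if $r=\omega$) if: (1) $M$ is second countable and Hausdorff; (2) there is an open cover $\mathcal{C}=\{U_\lambda:\lambda\in\Lambda\}$ of $M$ by bundled coordinate charts, any two of which are $C^r$ comparable; (3) if a bundled coordinate chart $V$ is comparable with $U_\lambda$ for all $\lambda\in\Lambda$, then $V\in\mathcal{C}$. *)

theory Defs
  imports "HOL-Analysis.Analysis" "Jordan_Normal_Form.Matrix"
begin

hide_const (open) Finite_Cartesian_Product.mat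

section \<open>Real analytic maps between open subsets of Euclidean spaces\<close>

text \<open>
  Points of real n-space are functions \<open>x :: nat \<Rightarrow> real\<close> with \<open>x i = 0\<close> for all \<open>i \<ge> n\<close>, as in
  \<^const>\<open>Euclidean_space\<close>; multi-indices are encoded in the same way.
\<close>

definition multi_indices :: "nat \<Rightarrow> (nat \<Rightarrow> nat) set" where
  "multi_indices n = {\<alpha>. \<forall>i\<ge>n. \<alpha> i = 0}"

text \<open>
  Every coordinate is, around every point \<open>a\<close> of \<open>W\<close>, the (unconditional) sum of a power series
  in the \<open>x i - a i\<close>. This is only meant for \<open>W\<close> open in \<open>Euclidean_space n\<close>, so that the
  points of \<open>W\<close> near \<open>a\<close> form a full neighbourhood of \<open>a\<close>.
\<close>

definition real_analytic_map ::
  "nat \<Rightarrow> nat \<Rightarrow> (nat \<Rightarrow> real) set \<Rightarrow> ((nat \<Rightarrow> real) \<Rightarrow> nat \<Rightarrow> real) \<Rightarrow> bool" where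
  "real_analytic_map n m W f \<longleftrightarrow>
     (\<forall>a\<in>W. \<forall>j<m. \<exists>(c :: (nat \<Rightarrow> nat) \<Rightarrow> real) r. r > 0 \<and>
        (\<forall>x\<in>W. (\<forall>i<n. \<bar>x i - a i\<bar> < r) \<longrightarrow>
           ((\<lambda>\<alpha>. c \<alpha> * (\<Prod>i<n. (x i - a i) ^ \<alpha> i)) has_sum f x j) (multi_indices n)))"

section \<open>Bundled analytic manifolds\<close>

record 'a chart =
  chart_dim :: nat
  chart_dom :: "'a set"
  chart_map :: "'a \<Rightarrow> nat \<Rightarrow> real"

definition simple_chart :: "'a topology \<Rightarrow> 'a chart \<Rightarrow> bool" where
  "simple_chart X u \<longleftrightarrow>
     openin X (chart_dom u) \<and> chart_dom u \<noteq> {} \<and>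
     (\<exists>\<Theta>. openin (Euclidean_space (chart_dim u)) \<Theta> \<and>
        homeomorphic_map (subtopology X (chart_dom u))
          (subtopology (Euclidean_space (chart_dim u)) \<Theta>) (chart_map u))"

text \<open>
  A bundled chart is given by the finite set of its simple charts, whose dimensions are
  taken to be distinct; the chart itself is the intersection of their domains.
\<close>

definition bundle_dom :: "'a chart set \<Rightarrow> 'a set" where
  "bundle_dom B = (\<Inter>u\<in>B. chart_dom u)"

definition bundled_chart :: "'a topology \<Rightarrow> 'a chart set \<Rightarrow> bool" where
  "bundled_chart X B \<longleftrightarrow>
     finite B \<and> B \<noteq> {} \<and> (\<forall>u\<in>B. simple_chart X u) \<and> inj_on chart_dim B \<and>
     openin X (bundle_dom B) \<and> bundle_dom B \<noteq> {}"

definition transition_map :: "'a chart \<Rightarrow> 'a chart \<Rightarrow> (nat \<Rightarrow> real) \<Rightarrow> nat \<Rightarrow> real" where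
  "transition_map u v = chart_map v \<circ> inv_into (chart_dom u) (chart_map u)"

definition analytic_transition :: "'a chart \<Rightarrow> 'a chart \<Rightarrow> bool" where
  "analytic_transition u v \<longleftrightarrow>
     real_analytic_map (chart_dim u) (chart_dim v)
       (chart_map u ` (chart_dom u \<inter> chart_dom v)) (transition_map u v)"

definition analytic_comparable :: "'a chart set \<Rightarrow> 'a chart set \<Rightarrow> bool" where
  "analytic_comparable B C \<longleftrightarrow>
     (\<forall>u\<in>B. \<forall>v\<in>C. chart_dim u = chart_dim v \<longrightarrow>
        analytic_transition u v \<and> analytic_transition v u)"

definition bundled_analytic_manifold :: "'a topology \<Rightarrow> bool" where
  "bundled_analytic_manifold X \<longleftrightarrow>
     second_countable X \<and> Hausdorff_space X \<and>
     (\<exists>\<C>. (\<forall>B\<in>\<C>. bundled_chart X B) \<and>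
        (\<Union>B\<in>\<C>. bundle_dom B) = topspace X \<and>
        (\<forall>B\<in>\<C>. \<forall>C\<in>\<C>. analytic_comparable B C) \<and>
        (\<forall>V. bundled_chart X V \<and> (\<forall>B\<in>\<C>. analytic_comparable V B) \<longrightarrow> V \<in> \<C>))"

section \<open>The quotient space of matrices of a fixed shape\<close>

definition mu_y :: "rat \<Rightarrow> nat" where
  "mu_y \<mu> = nat (fst (quotient_of \<mu>))"

definition mu_x :: "rat \<Rightarrow> nat" where
  "mu_x \<mu> = nat (snd (quotient_of \<mu>))"

lemma mu_y_mu_x:
  assumes "\<mu> > 0"
  shows "mu_y \<mu> > 0" "mu_x \<mu> > 0" "coprime (mu_y \<mu>) (mu_x \<mu>)"
    "\<mu> = of_nat (mu_y \<mu>) / of_nat (mu_x \<mu>)"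
proof -
  obtain p q where pq: "quotient_of \<mu> = (p, q)"
    by (cases "quotient_of \<mu>")
  have q: "q > 0" and c: "coprime p q" and d: "\<mu> = of_int p / of_int q"
    using pq quotient_of_denom_pos quotient_of_coprime quotient_of_div by blast+
  have p: "p > 0"
    using assms q d by (simp add: zero_less_divide_iff)
  show "mu_y \<mu> > 0" "mu_x \<mu> > 0"
    using p q by (simp_all add: mu_y_def mu_x_def pq)
  show "coprime (mu_y \<mu>) (mu_x \<mu>)"
    using p q c by (simp add: mu_y_def mu_x_def pq coprime_nat_abs_left_iff flip: coprime_int_iff)
  show "\<mu> = of_nat (mu_y \<mu>) / of_nat (mu_x \<mu>)"
    unfolding mu_y_def mu_x_def pq using p q d by simp
qed

definition kronecker :: "real mat \<Rightarrow> real mat \<Rightarrow> real mat" where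
  "kronecker A B = Matrix.mat (dim_row A * dim_row B) (dim_col A * dim_col B)
     (\<lambda>(i, j). A $$ (i div dim_row B, j div dim_col B) * B $$ (i mod dim_row B, j mod dim_col B))"

definition M_lev :: "rat \<Rightarrow> nat \<Rightarrow> real mat set" where
  "M_lev \<mu> i = carrier_mat (i * mu_y \<mu>) (i * mu_x \<mu>)"

definition M_all :: "rat \<Rightarrow> real mat set" where
  "M_all \<mu> = (\<Union>i\<in>{1..}. M_lev \<mu> i)"

definition mat_equiv :: "rat \<Rightarrow> (real mat \<times> real mat) set" where
  "mat_equiv \<mu> = {(A, B). A \<in> M_all \<mu> \<and> B \<in> M_all \<mu> \<and>
     (\<exists>s t. s > 0 \<and> t > 0 \<and> kronecker A (1\<^sub>m s) = kronecker B (1\<^sub>m t))}"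

definition Sigma_mu :: "rat \<Rightarrow> real mat set set" where
  "Sigma_mu \<mu> = M_all \<mu> // mat_equiv \<mu>"

text \<open>
  The Euclidean distance on \<open>M_lev \<mu> i\<close>, the matrix being viewed as the vector of its entries.
\<close>

definition mat_dist :: "real mat \<Rightarrow> real mat \<Rightarrow> real" where
  "mat_dist A B = L2_set (\<lambda>(p, q). A $$ (p, q) - B $$ (p, q)) ({..<dim_row A} \<times> {..<dim_col A})"

definition M_ball :: "rat \<Rightarrow> nat \<Rightarrow> real mat \<Rightarrow> real \<Rightarrow> real mat set" where
  "M_ball \<mu> i A r = {B \<in> M_lev \<mu> i. mat_dist A B < r}"

definition sub_basic :: "rat \<Rightarrow> real mat set \<Rightarrow> real mat set set" where
  "sub_basic \<mu> U = {c \<in> Sigma_mu \<mu>. c \<inter> U \<noteq> {}}"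

definition Sigma_top :: "rat \<Rightarrow> real mat set topology" where
  "Sigma_top \<mu> = topology_generated_by
     {sub_basic \<mu> (M_ball \<mu> i A r) | i A r.
        i \<ge> 1 \<and> A \<in> M_lev \<mu> i \<and> elements_mat A \<subseteq> \<rat> \<and> r \<in> \<rat> \<and> r > 0}"

lemma topspace_Sigma_top: "topspace (Sigma_top \<mu>) = Sigma_mu \<mu>"
proof
  show "topspace (Sigma_top \<mu>) \<subseteq> Sigma_mu \<mu>"
    by (auto simp: Sigma_top_def sub_basic_def)
  show "Sigma_mu \<mu> \<subseteq> topspace (Sigma_top \<mu>)"
  proof
    fix c assume c: "c \<in> Sigma_mu \<mu>"
    then obtain A where A: "A \<in> M_all \<mu>" and cA: "c = mat_equiv \<mu> `` {A}"
      by (auto simp: Sigma_mu_def elim: quotientE)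
    have "(A, A) \<in> mat_equiv \<mu>"
      using A by (auto simp: mat_equiv_def)
    then have Ac: "A \<in> c" by (simp add: cA)
    obtain i where i: "i \<ge> 1" "A \<in> M_lev \<mu> i"
      using A by (auto simp: M_all_def)
    define Z where "Z = (0\<^sub>m (i * mu_y \<mu>) (i * mu_x \<mu>) :: real mat)"
    obtain k :: nat where k: "mat_dist Z A < real k"
      using reals_Archimedean2 by blast
    have k': "mat_dist Z A < real (Suc k)"
      using k by simp
    have Z: "Z \<in> M_lev \<mu> i"
      by (simp add: Z_def M_lev_def)
    have Zr: "elements_mat Z \<subseteq> \<rat>"
      by (auto simp: Z_def elements_mat_def)
    have "c \<in> sub_basic \<mu> (M_ball \<mu> i Z (real (Suc k)))"
      using c Ac i k' by (auto simp: sub_basic_def M_ball_def)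
    moreover have "real (Suc k) \<in> \<rat>" "real (Suc k) > 0"
      by (auto intro: Rats_of_nat simp del: of_nat_Suc)
    ultimately show "c \<in> topspace (Sigma_top \<mu>)"
      using i Z Zr unfolding Sigma_top_def topology_generated_by_topspace by blast
  qed
qed

end

theory Submission
  imports Defs
begin

text \<open>
  If \<open>A\<close> of level \<open>i\<close> and \<open>B\<close> of level \<open>j\<close> are equivalent, both are inflations of a matrix of
  level \<open>gcd i j\<close>. Call \<open>A\<close> primitive if it is not equivalent to a matrix of lower level; then
  the levels at which its class has a representative are exactly the multiples of \<open>i\<close>, and every
  class contains exactly one primitive matrix. Being primitive is an open condition at each
  level, so \<open>Sigma_top \<mu>\<close> is the disjoint union of the open strata formed by the classes of
  primitive matrices of level \<open>i\<close>, and each stratum is homeomorphic to an open set of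
  matrices. These homeomorphisms have pairwise different dimensions, hence are trivially
  comparable, and extend to a maximal atlas.
\<close>

section \<open>Inflation by an identity matrix\<close>

text \<open>Equivalence quantifies over two unknown factors, but for matrices of levels
  \<open>i\<close> and \<open>j\<close> it reduces to one equation at the common level
  \<open>i * j\<close>. The matrix found there has blocks of size \<open>j\<close> and also blocks
  of size \<open>i\<close>. The two structures merge into blocks of size \<open>lcm i j\<close>, and
  as the product of gcd and lcm is \<open>i * j\<close>, undoing these blocks leaves level
  \<open>gcd i j\<close>. This merging is the core of the argument. Within the stratum of level
  \<open>i\<close>, a sub-basic set coming from level \<open>j\<close> is empty or the preimage of
  an open set under the linear map of inflation by \<open>j div i\<close>. So no level adds open
  sets beyond the Euclidean ones of the stratum. Primitivity is open because each of the finitely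
  many lower levels is excluded by the failure of a system of linear equations between
  entries.\<close>

abbreviation inflate :: "real mat \<Rightarrow> nat \<Rightarrow> real mat" where
  "inflate A k \<equiv> kronecker A (1\<^sub>m k)"

lemma dim_inflate [simp]:
  "dim_row (inflate A k) = dim_row A * k" "dim_col (inflate A k) = dim_col A * k"
  by (simp_all add: kronecker_def)

lemma inflate_index [simp]:
  assumes "k > 0" "p < dim_row A * k" "q < dim_col A * k"
  shows "inflate A k $$ (p, q) = (if p mod k = q mod k then A $$ (p div k, q div k) else 0)"
  using assms by (simp add: kronecker_def)

text \<open>Mixed radix arithmetic: a residue modulo \<open>s * t\<close> is determined by its last
  digit \<open>p mod t\<close> and the remaining part \<open>p div t mod s\<close>, so the two
  nested diagonal conditions amount to a single one.\<close>

lemma inflate_inflate: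
  assumes "s > 0" "t > 0"
  shows "inflate (inflate A s) t = inflate A (s * t)"
proof (rule eq_matI)
  fix p q assume "p < dim_row (inflate A (s * t))" "q < dim_col (inflate A (s * t))"
  then have p: "p < dim_row A * s * t" and q: "q < dim_col A * s * t"
    by (simp_all add: mult.assoc)
  have d: "p div t < dim_row A * s" "q div t < dim_col A * s"
    using p q assms by (simp_all add: less_mult_imp_div_less)
  have m: "p mod (s * t) = q mod (s * t) \<longleftrightarrow> p mod t = q mod t \<and> p div t mod s = q div t mod s"
  proof
    assume e: "p mod (s * t) = q mod (s * t)"
    have "p mod t = q mod t"
      using arg_cong[OF e, of "\<lambda>x. x mod t"] by (simp add: mod_mod_cancel)
    moreover have "t * (p div t mod s) + p mod t = t * (q div t mod s) + q mod t"
      using e mod_mult2_eq[of p t s] mod_mult2_eq[of q t s] by (simp add: mult.commute[of s t])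
    ultimately show "p mod t = q mod t \<and> p div t mod s = q div t mod s"
      using assms by simp
  next
    assume "p mod t = q mod t \<and> p div t mod s = q div t mod s"
    then show "p mod (s * t) = q mod (s * t)"
      using mod_mult2_eq[of p t s] mod_mult2_eq[of q t s] by (simp add: mult.commute[of s t])
  qed
  have "p div (s * t) = p div t div s" "q div (s * t) = q div t div s"
    using div_mult2_eq[of p t s] div_mult2_eq[of q t s] by (simp_all add: mult.commute[of s t])
  then show "inflate (inflate A s) t $$ (p, q) = inflate A (s * t) $$ (p, q)"
    using p q d assms m by (simp add: mult.assoc)
qed simp_all

text \<open>The top left corners of the blocks already spell out \<open>A\<close>.\<close>

lemma inflate_inject:
  assumes "k > 0" and eq: "inflate A k = inflate B k"
  shows "A = B"
proof (rule eq_matI)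
  show dr: "dim_row A = dim_row B" and dc: "dim_col A = dim_col B"
    using arg_cong[OF eq, of dim_row] arg_cong[OF eq, of dim_col] assms(1) by simp_all
  fix p q assume "p < dim_row B" "q < dim_col B"
  then show "A $$ (p, q) = B $$ (p, q)"
    using arg_cong[OF eq, of "\<lambda>M. M $$ (p * k, q * k)"] assms(1) dr dc by simp
qed

text \<open>Recognises an inflation without naming the matrix it comes from, by comparing each entry
  with the top left corner of its block. Being a system of equations between entries, it can be
  combined for two block sizes, and its failure is an open condition. Divisibility of the dimensions
  by \<open>k\<close> is a separate requirement of \<open>inflated_imp_inflate\<close>.\<close>

definition inflated :: "nat \<Rightarrow> real mat \<Rightarrow> bool" where
  "inflated k C \<longleftrightarrow> (\<forall>p<dim_row C. \<forall>q<dim_col C.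
     C $$ (p, q) = (if p mod k = q mod k then C $$ (k * (p div k), k * (q div k)) else 0))"

lemma inflatedD:
  "inflated k C \<Longrightarrow> p < dim_row C \<Longrightarrow> q < dim_col C \<Longrightarrow>
    C $$ (p, q) = (if p mod k = q mod k then C $$ (k * (p div k), k * (q div k)) else 0)"
  unfolding inflated_def by meson

lemma inflated_inflate:
  assumes "k > 0"
  shows "inflated k (inflate A k)"
proof -
  have "k * (p div k) < m * k" if "p < m * k" for p m :: nat
    using that by (metis le_less_trans times_div_less_eq_dividend)
  then show ?thesis
    using assms by (simp add: inflated_def)
qed

lemma inflated_imp_inflate:
  assumes "k > 0" "C \<in> carrier_mat (m * k) (n * k)" "inflated k C"
  obtains B where "B \<in> carrier_mat m n" "C = inflate B k"
proof
  let ?B = "Matrix.mat m n (\<lambda>(p, q). C $$ (k * p, k * q))"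
  show "?B \<in> carrier_mat m n"
    by simp
  show "C = inflate ?B k"
  proof (rule eq_matI)
    fix p q assume "p < dim_row (inflate ?B k)" "q < dim_col (inflate ?B k)"
    then have p: "p < m * k" and q: "q < n * k"
      by simp_all
    have "C $$ (p, q) = (if p mod k = q mod k then C $$ (k * (p div k), k * (q div k)) else 0)"
      by (rule inflatedD[OF assms(3)]) (use assms(2) p q in auto)
    then show "C $$ (p, q) = inflate ?B k $$ (p, q)"
      using assms(1) p q by (simp add: less_mult_imp_div_less)
  qed (use assms(2) in auto)
qed

text \<open>
  Inside a diagonal run of length \<open>lcm a b\<close>, two neighbouring entries lie in a common block of
  size \<open>a\<close> or in a common block of size \<open>b\<close>, because only multiples of both are barriers.
\<close>

lemma inflated_lcm:
  assumes ab: "a > 0" "b > 0" and a: "inflated a C" and b: "inflated b C"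
  shows "inflated (lcm a b) C"
proof -
  define L where "L = lcm a b"
  have L: "L > 0" "a dvd L" "b dvd L"
    using ab by (auto simp: L_def lcm_pos_nat)
  have step: "C $$ (L * x + Suc u, L * y + Suc u) = C $$ (L * x + u, L * y + u)"
    if bd: "L * x + Suc u < dim_row C" "L * y + Suc u < dim_col C" and k: "\<not> k dvd Suc u"
      and kL: "k dvd L" and kC: "inflated k C"
    for x y u k
  proof -
    \<comment> \<open>A new block of size \<open>k\<close> starts only at a multiple of
      \<open>k\<close>; the offset \<open>L * z\<close> is such a multiple and so does not move
      these barriers.\<close>
    have s: "(L * z + Suc u) div k = (L * z + u) div k" for z
    proof -
      have "\<not> k dvd L * z + Suc u"
        using k kL by (simp only: dvd_add_right_iff dvd_mult2 not_False_eq_True)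
      then have "Suc (L * z + u) mod k \<noteq> 0"
        by (simp add: dvd_eq_mod_eq_0)
      then show ?thesis
        by (simp add: div_Suc)
    qed
    \<comment> \<open>Equal offsets give row and column the same residue, so the entry lies on the
      diagonal of its block.\<close>
    have m: "(L * x + v) mod k = (L * y + v) mod k" for v
    proof -
      have "L * x mod k = L * y mod k"
        using kL by simp
      then show ?thesis
        by (rule mod_add_cong) simp
    qed
    have "C $$ (L * x + v, L * y + v) = C $$ (k * ((L * x + v) div k), k * ((L * y + v) div k))"
      if "L * x + v < dim_row C" "L * y + v < dim_col C" for v
      using inflatedD[OF kC that] m[of v] by simp
    from this[of u] this[of "Suc u"] show ?thesis
      using bd s by simp
  qed
  have run: "C $$ (L * x + u, L * y + u) = C $$ (L * x, L * y)"
    if "u < L" "L * x + u < dim_row C" "L * y + u < dim_col C" for x y u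
    using that
  proof (induction u)
    case (Suc u)
    have "\<not> L dvd Suc u"
      using Suc.prems(1) by (intro nat_dvd_not_less) auto
    then have "\<not> (a dvd Suc u \<and> b dvd Suc u)"
      unfolding L_def using lcm_least by blast
    then have "C $$ (L * x + Suc u, L * y + Suc u) = C $$ (L * x + u, L * y + u)"
      using step Suc.prems a b L by blast
    then show ?case
      using Suc by simp
  qed simp
  show ?thesis
    unfolding inflated_def L_def[symmetric]
  proof (intro allI impI)
    fix p q assume p: "p < dim_row C" and q: "q < dim_col C"
    show "C $$ (p, q) = (if p mod L = q mod L then C $$ (L * (p div L), L * (q div L)) else 0)"
    proof (cases "p mod L = q mod L")
      case True
      then show ?thesis
        using run[of "p mod L" "p div L" "q div L"] p q L(1) mult_div_mod_eq[of L p] mult_div_mod_eq[of L q]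
          by (simp only: True mod_less_divisor if_True)
    next
      case False
      \<comment> \<open>Congruence modulo both sizes would give congruence modulo \<open>L\<close>,
        so one of the two structures forces a zero. The integers allow for either sign of the
        difference.\<close>
      have "\<not> (p mod a = q mod a \<and> p mod b = q mod b)"
      proof
        assume "p mod a = q mod a \<and> p mod b = q mod b"
        then have "int a dvd int p - int q" "int b dvd int p - int q"
          by (simp_all flip: mod_eq_dvd_iff zmod_int)
        then have "int L dvd int p - int q"
          using lcm_least[of "int a" "int p - int q" "int b"] by (simp add: L_def)
        then have "int p mod int L = int q mod int L"
          by (simp add: mod_eq_dvd_iff)
        with False show False
          by (simp flip: zmod_int)
      qed
      moreover have "C $$ (p, q) = 0" if "inflated k C" "p mod k \<noteq> q mod k" for k
        using inflatedD[OF that(1) p q] that(2) by simp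
      ultimately show ?thesis
        using False a b by auto
    qed
  qed
qed

section \<open>Equivalence classes\<close>

lemma M_lev_imp_M_all: "i > 0 \<Longrightarrow> A \<in> M_lev \<mu> i \<Longrightarrow> A \<in> M_all \<mu>"
  by (auto simp: M_all_def)

lemma inflate_M_lev: "A \<in> M_lev \<mu> i \<Longrightarrow> inflate A k \<in> M_lev \<mu> (i * k)"
  by (auto simp: M_lev_def)

lemma mat_equivI:
  "A \<in> M_all \<mu> \<Longrightarrow> B \<in> M_all \<mu> \<Longrightarrow> s > 0 \<Longrightarrow> t > 0 \<Longrightarrow> inflate A s = inflate B t \<Longrightarrow>
    (A, B) \<in> mat_equiv \<mu>"
  unfolding mat_equiv_def by blast

lemma equiv_mat_equiv: "equiv (M_all \<mu>) (mat_equiv \<mu>)"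
proof (rule equivI)
  show "mat_equiv \<mu> \<subseteq> M_all \<mu> \<times> M_all \<mu>"
    by (auto simp: mat_equiv_def)
  show "refl_on (M_all \<mu>) (mat_equiv \<mu>)"
    by (auto simp: refl_on_def mat_equiv_def)
  show "sym (mat_equiv \<mu>)"
  proof (rule symI)
    fix A B assume "(A, B) \<in> mat_equiv \<mu>"
    then obtain s t where "A \<in> M_all \<mu>" "B \<in> M_all \<mu>" "s > 0" "t > 0" "inflate A s = inflate B t"
      unfolding mat_equiv_def by blast
    then show "(B, A) \<in> mat_equiv \<mu>"
      by (intro mat_equivI[of B \<mu> A t s]) simp_all
  qed
  show "trans (mat_equiv \<mu>)"
  proof (rule transI)
    fix A B C assume "(A, B) \<in> mat_equiv \<mu>" "(B, C) \<in> mat_equiv \<mu>"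
    then obtain s t u v where A: "A \<in> M_all \<mu>" and C: "C \<in> M_all \<mu>"
      and pos: "s > 0" "t > 0" "u > 0" "v > 0"
      and e: "inflate A s = inflate B t" "inflate B u = inflate C v"
      by (auto simp: mat_equiv_def)
    \<comment> \<open>Both given equations are inflated until they share the inflation of
      \<open>B\<close> by \<open>t * u\<close>.\<close>
    have "inflate A (s * u) = inflate (inflate B t) u"
      using pos by (simp add: inflate_inflate flip: e)
    also have "\<dots> = inflate (inflate B u) t"
      using pos by (simp add: inflate_inflate mult.commute)
    also have "\<dots> = inflate C (v * t)"
      using pos by (simp add: e inflate_inflate)
    finally have "inflate A (s * u) = inflate C (v * t)" .
    moreover have "s * u > 0" "v * t > 0"
      using pos by simp_all
    ultimately show "(A, C) \<in> mat_equiv \<mu>"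
      using A C by (intro mat_equivI)
  qed
qed

text \<open>Row counts give \<open>i * s = j * t\<close>, as \<open>mu_y \<mu>\<close> is positive.
  Inflating the given equation by \<open>j\<close> then turns both sides into inflations by
  \<open>s\<close> of matrices of level \<open>i * j\<close>, and \<open>s\<close> cancels.\<close>

lemma mat_equiv_iff:
  assumes \<mu>: "\<mu> > 0" and i: "i > 0" "A \<in> M_lev \<mu> i" and j: "j > 0" "B \<in> M_lev \<mu> j"
  shows "(A, B) \<in> mat_equiv \<mu> \<longleftrightarrow> inflate A j = inflate B i"
proof
  assume "(A, B) \<in> mat_equiv \<mu>"
  then obtain s t where st: "s > 0" "t > 0" and e: "inflate A s = inflate B t"
    by (auto simp: mat_equiv_def)
  have "i * s = j * t"
    using arg_cong[OF e, of dim_row] i j mu_y_mu_x(1)[OF \<mu>] by (simp add: M_lev_def ac_simps)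
  then have "inflate (inflate A j) s = inflate (inflate B i) s"
    using st i j arg_cong[OF e, of "\<lambda>M. inflate M j"] by (simp add: inflate_inflate mult.commute)
  then show "inflate A j = inflate B i"
    using inflate_inject st by blast
next
  assume "inflate A j = inflate B i"
  then show "(A, B) \<in> mat_equiv \<mu>"
    using i j by (intro mat_equivI M_lev_imp_M_all)
qed

lemma mat_equiv_inflate:
  assumes "i > 0" "k > 0" "A \<in> M_lev \<mu> i"
  shows "(A, inflate A k) \<in> mat_equiv \<mu>"
proof -
  have "inflate (inflate A k) 1 = inflate A k"
    using assms inflate_inflate[of k 1 A] by simp
  moreover have "A \<in> M_all \<mu>" "inflate A k \<in> M_all \<mu>"
    using assms M_lev_imp_M_all inflate_M_lev nat_0_less_mult_iff by blast+
  ultimately show ?thesis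
    using assms(2) by (intro mat_equivI[of A \<mu> _ k 1]) simp_all
qed

text \<open>For equal levels the equation of \<open>mat_equiv_iff\<close> has the same factor on
  both sides, which cancels. This is what makes coordinates on classes possible.\<close>

lemma Sigma_mu_rep_unique:
  assumes \<mu>: "\<mu> > 0" and c: "c \<in> Sigma_mu \<mu>" and i: "i > 0"
    and A: "A \<in> c" "A \<in> M_lev \<mu> i" and B: "B \<in> c" "B \<in> M_lev \<mu> i"
  shows "A = B"
proof -
  have "(A, B) \<in> mat_equiv \<mu>"
    using c A B equiv_mat_equiv quotient_eq_iff unfolding Sigma_mu_def by fastforce
  then show ?thesis
    using mat_equiv_iff[OF \<mu> i A(2) i B(2)] inflate_inject[OF i] by blast
qed

section \<open>Openness of sets of matrices\<close>

text \<open>Openness for the maximum norm, relative to one shape because the type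
  \<open>real mat\<close> contains all shapes. The Euclidean balls are compared with it in
  \<open>mat_open_M_ball\<close> and \<open>openin_sub_basic\<close>.\<close>

definition mat_open :: "nat \<Rightarrow> nat \<Rightarrow> real mat set \<Rightarrow> bool" where
  "mat_open m n W \<longleftrightarrow> W \<subseteq> carrier_mat m n \<and>
     (\<forall>A\<in>W. \<exists>e>0. \<forall>B\<in>carrier_mat m n.
        (\<forall>p<m. \<forall>q<n. \<bar>A $$ (p, q) - B $$ (p, q)\<bar> < e) \<longrightarrow> B \<in> W)"

lemma mat_openD:
  assumes "mat_open m n W" "A \<in> W"
  obtains e where "e > 0"
    "\<And>B. B \<in> carrier_mat m n \<Longrightarrow> (\<And>p q. p < m \<Longrightarrow> q < n \<Longrightarrow> \<bar>A $$ (p, q) - B $$ (p, q)\<bar> < e) \<Longrightarrow> B \<in> W"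
  using assms unfolding mat_open_def by meson

lemma mat_open_carrier: "mat_open m n (carrier_mat m n)"
  by (auto simp: mat_open_def intro: exI[of _ 1])

lemma mat_open_empty: "mat_open m n {}"
  by (auto simp: mat_open_def)

lemma mat_open_Int:
  assumes "mat_open m n V" "mat_open m n W"
  shows "mat_open m n (V \<inter> W)"
  unfolding mat_open_def
proof (intro conjI ballI)
  show "V \<inter> W \<subseteq> carrier_mat m n"
    using assms by (auto simp: mat_open_def)
  fix A assume A: "A \<in> V \<inter> W"
  obtain d where d: "d > 0"
    "\<And>B. B \<in> carrier_mat m n \<Longrightarrow> (\<And>p q. p < m \<Longrightarrow> q < n \<Longrightarrow> \<bar>A $$ (p, q) - B $$ (p, q)\<bar> < d) \<Longrightarrow> B \<in> V"
    using A assms(1) mat_openD by (metis IntD1)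
  obtain e where e: "e > 0"
    "\<And>B. B \<in> carrier_mat m n \<Longrightarrow> (\<And>p q. p < m \<Longrightarrow> q < n \<Longrightarrow> \<bar>A $$ (p, q) - B $$ (p, q)\<bar> < e) \<Longrightarrow> B \<in> W"
    using A assms(2) mat_openD by (metis IntD2)
  show "\<exists>e>0. \<forall>B\<in>carrier_mat m n. (\<forall>p<m. \<forall>q<n. \<bar>A $$ (p, q) - B $$ (p, q)\<bar> < e) \<longrightarrow> B \<in> V \<inter> W"
    using d e by (intro exI[of _ "min d e"]) auto
qed

text \<open>The carrier is a factor of its own so that an empty \<open>I\<close> yields the whole
  space, as happens for primitive matrices of level 1.\<close>

lemma mat_open_INT:
  assumes "finite I" "\<And>i. i \<in> I \<Longrightarrow> mat_open m n (W i)"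
  shows "mat_open m n (carrier_mat m n \<inter> (\<Inter>i\<in>I. W i))"
  using assms
proof (induction I)
  case (insert i I)
  have "mat_open m n (W i \<inter> (carrier_mat m n \<inter> (\<Inter>i\<in>I. W i)))"
    by (intro mat_open_Int insert.IH insert.prems) simp_all
  also have "W i \<inter> (carrier_mat m n \<inter> (\<Inter>i\<in>I. W i)) = carrier_mat m n \<inter> (\<Inter>i\<in>insert i I. W i)"
    by auto
  finally show ?case .
qed (simp add: mat_open_carrier)

text \<open>Every entry of an inflation is an entry of the original matrix or 0, so inflation does
  not increase the maximum distance and the same \<open>e\<close> serves.\<close>

lemma mat_open_inflate_vimage:
  assumes k: "k > 0" and W: "mat_open (m * k) (n * k) W"
  shows "mat_open m n {A \<in> carrier_mat m n. inflate A k \<in> W}"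
  unfolding mat_open_def
proof (intro conjI ballI)
  fix A assume "A \<in> {A \<in> carrier_mat m n. inflate A k \<in> W}"
  then have A: "A \<in> carrier_mat m n" "inflate A k \<in> W"
    by auto
  then obtain e where e: "e > 0" "\<And>B. B \<in> carrier_mat (m * k) (n * k) \<Longrightarrow>
     (\<And>p q. p < m * k \<Longrightarrow> q < n * k \<Longrightarrow> \<bar>inflate A k $$ (p, q) - B $$ (p, q)\<bar> < e) \<Longrightarrow> B \<in> W"
    using mat_openD[OF W] by metis
  have "inflate B k \<in> W" if "B \<in> carrier_mat m n" "\<forall>p<m. \<forall>q<n. \<bar>A $$ (p, q) - B $$ (p, q)\<bar> < e" for B
    using that e(1) A(1) k by (intro e(2)) (auto simp: less_mult_imp_div_less)
  then show "\<exists>e>0. \<forall>B\<in>carrier_mat m n. (\<forall>p<m. \<forall>q<n. \<bar>A $$ (p, q) - B $$ (p, q)\<bar> < e) \<longrightarrow>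
      B \<in> {A \<in> carrier_mat m n. inflate A k \<in> W}"
    using e(1) by blast
qed auto

lemma mat_open_not_inflated:
  assumes "k > 0"
  shows "mat_open m n {C \<in> carrier_mat m n. \<not> inflated k C}"
  unfolding mat_open_def
proof (intro conjI ballI)
  fix A assume "A \<in> {C \<in> carrier_mat m n. \<not> inflated k C}"
  then have A: "A \<in> carrier_mat m n" "\<not> inflated k A"
    by auto
  then obtain p q where p: "p < m" and q: "q < n"
    and ne: "A $$ (p, q) \<noteq> (if p mod k = q mod k then A $$ (k * (p div k), k * (q div k)) else 0)"
    unfolding inflated_def by (metis carrier_matD)
  \<comment> \<open>Half the defect of a violated equation: each side moves by less than
    \<open>e\<close>, which cannot close a gap of \<open>2 * e\<close>.\<close>
  define e where
    "e = \<bar>A $$ (p, q) - (if p mod k = q mod k then A $$ (k * (p div k), k * (q div k)) else 0)\<bar> / 2"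
  have e: "e > 0"
    using ne by (simp add: e_def)
  have p': "k * (p div k) < m" and q': "k * (q div k) < n"
    using p q times_div_less_eq_dividend le_less_trans by blast+
  have "\<not> inflated k B"
    if B: "B \<in> carrier_mat m n" and cl: "\<forall>p<m. \<forall>q<n. \<bar>A $$ (p, q) - B $$ (p, q)\<bar> < e" for B
  proof
    assume "inflated k B"
    then have "B $$ (p, q) = (if p mod k = q mod k then B $$ (k * (p div k), k * (q div k)) else 0)"
      using B p q by (intro inflatedD) auto
    moreover have "\<bar>A $$ (p, q) - B $$ (p, q)\<bar> < e"
      "\<bar>A $$ (k * (p div k), k * (q div k)) - B $$ (k * (p div k), k * (q div k))\<bar> < e"
      using cl p q p' q' by auto
    ultimately show False
      unfolding e_def by (cases "p mod k = q mod k") (simp_all add: abs_if split: if_splits)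
  qed
  then show "\<exists>e>0. \<forall>B\<in>carrier_mat m n. (\<forall>p<m. \<forall>q<n. \<bar>A $$ (p, q) - B $$ (p, q)\<bar> < e) \<longrightarrow>
      B \<in> {C \<in> carrier_mat m n. \<not> inflated k C}"
    using e by blast
qed auto

lemma mat_dist_alt:
  "A \<in> carrier_mat m n \<Longrightarrow> mat_dist A B = L2_set (\<lambda>x. A $$ x - B $$ x) ({..<m} \<times> {..<n})"
  by (auto simp: mat_dist_def intro!: L2_set_cong)

lemma entry_le_mat_dist:
  assumes "A \<in> carrier_mat m n" "p < m" "q < n"
  shows "\<bar>A $$ (p, q) - B $$ (p, q)\<bar> \<le> mat_dist A B"
proof -
  have "\<bar>A $$ (p, q) - B $$ (p, q)\<bar> \<le> L2_set (\<lambda>x. \<bar>A $$ x - B $$ x\<bar>) ({..<m} \<times> {..<n})"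
    using assms by (intro member_le_L2_set[of _ "(p, q)" "\<lambda>x. \<bar>A $$ x - B $$ x\<bar>"]) auto
  then show ?thesis
    using assms by (simp add: mat_dist_alt L2_set_def)
qed

text \<open>The norm is at most the sum of \<open>m * n\<close> absolute values; the extra 1 makes
  the bound strict and keeps the denominator positive for shapes without entries.\<close>

lemma mat_dist_less:
  assumes A: "A \<in> carrier_mat m n" and e: "e > 0"
    and cl: "\<And>p q. p < m \<Longrightarrow> q < n \<Longrightarrow> \<bar>A $$ (p, q) - B $$ (p, q)\<bar> < e / (real (m * n) + 1)"
  shows "mat_dist A B < e"
proof -
  have "mat_dist A B \<le> (\<Sum>x\<in>{..<m} \<times> {..<n}. \<bar>A $$ x - B $$ x\<bar>)"
    unfolding mat_dist_alt[OF A] by (rule L2_set_le_sum_abs)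
  also have "\<dots> \<le> (\<Sum>x\<in>{..<m} \<times> {..<n}. e / (real (m * n) + 1))"
    using cl by (intro sum_mono) (auto simp: less_imp_le)
  also have "\<dots> = real (m * n) * (e / (real (m * n) + 1))"
    by simp
  also have "\<dots> < (real (m * n) + 1) * (e / (real (m * n) + 1))"
    using e by (intro mult_strict_right_mono divide_pos_pos add_nonneg_pos) auto
  also have "\<dots> = e"
    by (simp add: add_nonneg_eq_0_iff del: of_nat_mult)
  finally show ?thesis .
qed

lemma mat_dist_triangle:
  assumes "A \<in> carrier_mat m n" "B \<in> carrier_mat m n"
  shows "mat_dist A C \<le> mat_dist A B + mat_dist B C"
proof -
  have "mat_dist A C = L2_set (\<lambda>x. (A $$ x - B $$ x) + (B $$ x - C $$ x)) ({..<m} \<times> {..<n})"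
    by (simp add: mat_dist_alt[OF assms(1)])
  also have "\<dots> \<le> mat_dist A B + mat_dist B C"
    unfolding mat_dist_alt[OF assms(1)] mat_dist_alt[OF assms(2)] by (rule L2_set_triangle_ineq)
  finally show ?thesis .
qed

lemma mat_open_M_ball:
  assumes "A \<in> M_lev \<mu> i"
  shows "mat_open (i * mu_y \<mu>) (i * mu_x \<mu>) (M_ball \<mu> i A r)"
  unfolding mat_open_def
proof (intro conjI ballI)
  let ?m = "i * mu_y \<mu>" and ?n = "i * mu_x \<mu>"
  show "M_ball \<mu> i A r \<subseteq> carrier_mat ?m ?n"
    by (auto simp: M_ball_def M_lev_def)
  fix B assume B: "B \<in> M_ball \<mu> i A r"
  then have Bc: "B \<in> carrier_mat ?m ?n" and d: "r - mat_dist A B > 0"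
    by (auto simp: M_ball_def M_lev_def)
  let ?e = "(r - mat_dist A B) / (real (?m * ?n) + 1)"
  have "C \<in> M_ball \<mu> i A r"
    if C: "C \<in> carrier_mat ?m ?n" and cl: "\<forall>p<?m. \<forall>q<?n. \<bar>B $$ (p, q) - C $$ (p, q)\<bar> < ?e" for C
  proof -
    have "mat_dist B C < r - mat_dist A B"
      using mat_dist_less[OF Bc d] cl by blast
    then have "mat_dist A C < r"
      using mat_dist_triangle[of A ?m ?n B C] assms Bc by (simp add: M_lev_def)
    then show ?thesis
      using C by (simp add: M_ball_def M_lev_def)
  qed
  moreover have "?e > 0"
    using d by (intro divide_pos_pos add_nonneg_pos) auto
  ultimately show "\<exists>e>0. \<forall>C\<in>carrier_mat ?m ?n.
      (\<forall>p<?m. \<forall>q<?n. \<bar>B $$ (p, q) - C $$ (p, q)\<bar> < e) \<longrightarrow> C \<in> M_ball \<mu> i A r"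
    by blast
qed

lemma exists_rational_matrix_near:
  fixes e :: real
  assumes "e > 0"
  obtains B :: "real mat" where "B \<in> carrier_mat m n" "elements_mat B \<subseteq> \<rat>"
    "\<And>p q. p < m \<Longrightarrow> q < n \<Longrightarrow> \<bar>B $$ (p, q) - A $$ (p, q)\<bar> < e"
proof -
  have "\<exists>x\<in>\<rat>. \<bar>x - y\<bar> < e" for y :: real
  proof -
    obtain x where "x \<in> \<rat>" "y - e < x" "x < y + e"
      using Rats_dense_in_real[of "y - e" "y + e"] assms by auto
    then show ?thesis
      by (intro bexI[of _ x]) (auto simp: abs_less_iff)
  qed
  then obtain f where f: "\<And>y :: real. f y \<in> \<rat>" "\<And>y. \<bar>f y - y\<bar> < e"
    by metis
  show ?thesis
    using f by (intro that[of "Matrix.mat m n (\<lambda>x. f (A $$ x))"]) (auto simp: elements_mat_def)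
qed

text \<open>Enlarges the supply of open sets from rational balls to all open sets of one
  level.\<close>

lemma openin_sub_basic:
  assumes i: "i > 0" and W: "mat_open (i * mu_y \<mu>) (i * mu_x \<mu>) W"
  shows "openin (Sigma_top \<mu>) (sub_basic \<mu> W)"
proof (subst openin_subopen, intro ballI)
  let ?m = "i * mu_y \<mu>" and ?n = "i * mu_x \<mu>"
  fix c assume "c \<in> sub_basic \<mu> W"
  then obtain A where c: "c \<in> Sigma_mu \<mu>" and A: "A \<in> c" "A \<in> W"
    by (auto simp: sub_basic_def)
  then obtain e where e: "e > 0" "\<And>B. B \<in> carrier_mat ?m ?n \<Longrightarrow>
      (\<And>p q. p < ?m \<Longrightarrow> q < ?n \<Longrightarrow> \<bar>A $$ (p, q) - B $$ (p, q)\<bar> < e) \<Longrightarrow> B \<in> W"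
    using mat_openD[OF W] by metis
  have Ac: "A \<in> carrier_mat ?m ?n"
    using A W by (auto simp: mat_open_def)
  \<comment> \<open>A rational centre \<open>Q\<close> within \<open>r\<close> of \<open>A\<close>
    gives a ball that contains \<open>A\<close>, and each entry of a member differs from that of
    \<open>A\<close> by less than \<open>2 * r < e\<close>.\<close>
  obtain r where r: "r \<in> \<rat>" "0 < r" "r < e / 2"
    using Rats_dense_in_real[of 0 "e / 2"] e(1) by auto
  have "r / (real (?m * ?n) + 1) > 0"
    using r(2) by (intro divide_pos_pos add_nonneg_pos) auto
  then obtain Q where Q: "Q \<in> carrier_mat ?m ?n" "elements_mat Q \<subseteq> \<rat>"
    "\<And>p q. p < ?m \<Longrightarrow> q < ?n \<Longrightarrow> \<bar>Q $$ (p, q) - A $$ (p, q)\<bar> < r / (real (?m * ?n) + 1)"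
    by (rule exists_rational_matrix_near) blast
  have QA: "mat_dist Q A < r"
    using mat_dist_less[OF Q(1) r(2) Q(3)] .
  have "M_ball \<mu> i Q r \<subseteq> W"
  proof
    fix B assume "B \<in> M_ball \<mu> i Q r"
    then have B: "B \<in> carrier_mat ?m ?n" "mat_dist Q B < r"
      by (auto simp: M_ball_def M_lev_def)
    show "B \<in> W"
    proof (rule e(2)[OF B(1)])
      fix p q assume "p < ?m" "q < ?n"
      then have "\<bar>Q $$ (p, q) - B $$ (p, q)\<bar> < r" "\<bar>Q $$ (p, q) - A $$ (p, q)\<bar> < r"
        using entry_le_mat_dist[OF Q(1), of p q A] entry_le_mat_dist[OF Q(1), of p q B] QA B(2) by auto
      then show "\<bar>A $$ (p, q) - B $$ (p, q)\<bar> < e"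
        using r(3) by linarith
    qed
  qed
  then have "sub_basic \<mu> (M_ball \<mu> i Q r) \<subseteq> sub_basic \<mu> W"
    by (auto simp: sub_basic_def)
  moreover have "c \<in> sub_basic \<mu> (M_ball \<mu> i Q r)"
    using c A Ac QA by (auto simp: sub_basic_def M_ball_def M_lev_def)
  moreover have "openin (Sigma_top \<mu>) (sub_basic \<mu> (M_ball \<mu> i Q r))"
    unfolding Sigma_top_def
  proof (rule topology_generated_by_Basis, intro CollectI exI conjI)
    show "Q \<in> M_lev \<mu> i"
      using Q(1) by (simp add: M_lev_def)
  qed (use i Q r in auto)
  ultimately show "\<exists>T. openin (Sigma_top \<mu>) T \<and> c \<in> T \<and> T \<subseteq> sub_basic \<mu> W"
    by blast
qed

section \<open>Primitive matrices\<close>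

text \<open>All lower levels are excluded, not only the divisors of \<open>i\<close>; a
  representative of least level is then primitive by definition.\<close>

definition primitive_mats :: "rat \<Rightarrow> nat \<Rightarrow> real mat set" where
  "primitive_mats \<mu> i = {A \<in> M_lev \<mu> i. \<forall>d\<in>{1..<i}. \<forall>B\<in>M_lev \<mu> d. (A, B) \<notin> mat_equiv \<mu>}"

text \<open>Removes the quantifier over \<open>B\<close>: the equation
  \<open>inflate A d = inflate B i\<close> can be solved for \<open>B\<close> exactly when
  \<open>inflate A d\<close> has blocks of size \<open>i\<close>, a condition on the entries of
  \<open>A\<close> alone.\<close>

lemma equiv_level_iff_inflated:
  assumes \<mu>: "\<mu> > 0" and i: "i > 0" "A \<in> M_lev \<mu> i" and d: "d > 0"
  shows "(\<exists>B\<in>M_lev \<mu> d. (A, B) \<in> mat_equiv \<mu>) \<longleftrightarrow> inflated i (inflate A d)"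
proof
  assume "\<exists>B\<in>M_lev \<mu> d. (A, B) \<in> mat_equiv \<mu>"
  then show "inflated i (inflate A d)"
    using mat_equiv_iff[OF \<mu> i d] inflated_inflate[OF i(1)] by metis
next
  assume "inflated i (inflate A d)"
  moreover have "inflate A d \<in> carrier_mat ((d * mu_y \<mu>) * i) ((d * mu_x \<mu>) * i)"
    using i(2) by (auto simp: M_lev_def)
  ultimately obtain B where "B \<in> carrier_mat (d * mu_y \<mu>) (d * mu_x \<mu>)" "inflate A d = inflate B i"
    using inflated_imp_inflate[OF i(1)] by metis
  then show "\<exists>B\<in>M_lev \<mu> d. (A, B) \<in> mat_equiv \<mu>"
    using mat_equiv_iff[OF \<mu> i d] unfolding M_lev_def by blast
qed

lemma mat_open_primitive_mats:
  assumes \<mu>: "\<mu> > 0" and i: "i > 0"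
  shows "mat_open (i * mu_y \<mu>) (i * mu_x \<mu>) (primitive_mats \<mu> i)"
proof -
  let ?m = "i * mu_y \<mu>" and ?n = "i * mu_x \<mu>"
  let ?W = "\<lambda>d. {A \<in> carrier_mat ?m ?n.
    inflate A d \<in> {C \<in> carrier_mat (?m * d) (?n * d). \<not> inflated i C}}"
  have "primitive_mats \<mu> i = carrier_mat ?m ?n \<inter> (\<Inter>d\<in>{1..<i}. ?W d)"
  proof (rule Set.set_eqI)
    fix A
    show "A \<in> primitive_mats \<mu> i \<longleftrightarrow> A \<in> carrier_mat ?m ?n \<inter> (\<Inter>d\<in>{1..<i}. ?W d)"
    proof (cases "A \<in> carrier_mat ?m ?n")
      case True
      then have A: "A \<in> M_lev \<mu> i"
        by (simp add: M_lev_def)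
      have "(\<forall>B\<in>M_lev \<mu> d. (A, B) \<notin> mat_equiv \<mu>) \<longleftrightarrow> A \<in> ?W d" if "d \<in> {1..<i}" for d
        using equiv_level_iff_inflated[OF \<mu> i A, of d] that True by auto
      then show ?thesis
        using True A by (simp add: primitive_mats_def)
    qed (simp add: primitive_mats_def M_lev_def)
  qed
  moreover have "mat_open ?m ?n (?W d)" if "d \<in> {1..<i}" for d
    using that i by (intro mat_open_inflate_vimage mat_open_not_inflated) auto
  ultimately show ?thesis
    using mat_open_INT[of "{1..<i}" ?m ?n ?W] by simp
qed

lemma primitive_mats_subset: "primitive_mats \<mu> i \<subseteq> M_lev \<mu> i"
  by (auto simp: primitive_mats_def)

text \<open>If \<open>g\<close> were smaller than \<open>i\<close>, undoing the blocks of size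
  \<open>L\<close> would produce an equivalent matrix \<open>D\<close> of lower level. So
  \<open>g = i\<close>, which is divisibility.\<close>

lemma primitive_equiv_dvd:
  assumes \<mu>: "\<mu> > 0" and i: "i > 0" "A \<in> primitive_mats \<mu> i" and j: "j > 0" "B \<in> M_lev \<mu> j"
    and AB: "(A, B) \<in> mat_equiv \<mu>"
  shows "i dvd j"
proof -
  have A: "A \<in> M_lev \<mu> i"
    using i(2) primitive_mats_subset by blast
  define C g L where "C = inflate A j" and "g = gcd i j" and "L = lcm i j"
  have pos: "g > 0" "L > 0"
    using i(1) j(1) by (simp_all add: g_def L_def lcm_pos_nat)
  have gL: "g * L = i * j"
    unfolding g_def L_def by (rule prod_gcd_lcm_nat[symmetric])
  have "C = inflate B i"
    using mat_equiv_iff[OF \<mu> i(1) A j] AB by (simp add: C_def)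
  then have "inflated L C"
    unfolding L_def using i(1) j(1) inflated_inflate C_def by (intro inflated_lcm) metis+
  \<comment> \<open>The identity \<open>g * L = i * j\<close> makes the dimensions of
    \<open>C\<close> multiples of \<open>L\<close>, with the dimensions of level \<open>g\<close> as
    quotients.\<close>
  moreover have "C \<in> carrier_mat ((g * mu_y \<mu>) * L) ((g * mu_x \<mu>) * L)"
  proof -
    have e: "(g * x) * L = (i * x) * j" for x
      using gL by (simp add: ac_simps)
    have "dim_row A = i * mu_y \<mu>" "dim_col A = i * mu_x \<mu>"
      using A by (auto simp: M_lev_def)
    then show ?thesis
      by (intro carrier_matI) (simp_all only: C_def dim_inflate e)
  qed
  ultimately obtain D where D: "D \<in> M_lev \<mu> g" "C = inflate D L"
    using inflated_imp_inflate[OF pos(2)] unfolding M_lev_def by metis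
  have "(A, D) \<in> mat_equiv \<mu>"
    by (rule mat_equivI[of A \<mu> D j L]) (use A D pos i j C_def M_lev_imp_M_all in auto)
  then have "\<not> g < i"
    using i(2) D(1) pos(1) by (auto simp: primitive_mats_def)
  moreover have "g \<le> i"
    using i(1) by (simp add: g_def gcd_le1_nat)
  ultimately show ?thesis
    unfolding g_def by (metis gcd_dvd2 le_neq_implies_less)
qed

text \<open>Inflating \<open>A\<close> by \<open>j div i\<close> gives one member of its class at
  level \<open>j\<close>, and uniqueness leaves no other.\<close>

lemma primitive_equiv_iff:
  assumes \<mu>: "\<mu> > 0" and i: "i > 0" "A \<in> primitive_mats \<mu> i" and j: "j > 0" "B \<in> M_lev \<mu> j"
  shows "(A, B) \<in> mat_equiv \<mu> \<longleftrightarrow> i dvd j \<and> B = inflate A (j div i)"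
proof -
  have A: "A \<in> M_lev \<mu> i"
    using i(2) primitive_mats_subset by blast
  have k: "j div i > 0 \<and> inflate A (j div i) \<in> M_lev \<mu> j \<and> (A, inflate A (j div i)) \<in> mat_equiv \<mu>"
    if "i dvd j"
    using that i(1) j(1) inflate_M_lev[OF A, of "j div i"] mat_equiv_inflate[OF i(1) _ A, of "j div i"]
    by (auto simp: dvd_div_eq_0_iff)
  show ?thesis
  proof
    assume AB: "(A, B) \<in> mat_equiv \<mu>"
    then have d: "i dvd j"
      using primitive_equiv_dvd[OF \<mu> i j] by blast
    let ?c = "mat_equiv \<mu> `` {A}"
    have "?c \<in> Sigma_mu \<mu>"
      using M_lev_imp_M_all[OF i(1) A] by (auto simp: Sigma_mu_def intro: quotientI)
    then have "B = inflate A (j div i)"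
      using Sigma_mu_rep_unique[OF \<mu> _ j(1), of ?c B] AB k[OF d] j(2) by blast
    then show "i dvd j \<and> B = inflate A (j div i)"
      using d by blast
  qed (use k in blast)
qed

lemma Sigma_mu_class:
  assumes "c \<in> Sigma_mu \<mu>" "A \<in> c"
  shows "c = mat_equiv \<mu> `` {A}" "A \<in> M_all \<mu>"
  using assms equiv_mat_equiv[of \<mu>] unfolding Sigma_mu_def
  by (metis Image_singleton_iff equiv_class_eq quotientE) (metis assms in_quotient_imp_subset equiv_mat_equiv Sigma_mu_def subsetD)

lemma class_in_Sigma_mu: "A \<in> M_all \<mu> \<Longrightarrow> mat_equiv \<mu> `` {A} \<in> Sigma_mu \<mu>"
  unfolding Sigma_mu_def by (rule quotientI)

lemma class_self: "A \<in> M_all \<mu> \<Longrightarrow> A \<in> mat_equiv \<mu> `` {A}"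
  by (rule equiv_class_self[OF equiv_mat_equiv])

lemma Sigma_mu_primitive_rep:
  assumes "c \<in> Sigma_mu \<mu>"
  obtains i A where "i > 0" "A \<in> primitive_mats \<mu> i" "A \<in> c"
proof -
  define P where "P i \<longleftrightarrow> i > 0 \<and> c \<inter> M_lev \<mu> i \<noteq> {}" for i
  obtain A where "A \<in> c"
    using assms class_self unfolding Sigma_mu_def by (metis quotientE)
  then obtain i where "i > 0" "A \<in> M_lev \<mu> i"
    using Sigma_mu_class(2)[OF assms \<open>A \<in> c\<close>] by (auto simp: M_all_def Suc_le_eq)
  then have "P i"
    using \<open>A \<in> c\<close> unfolding P_def by blast
  then have P: "P (LEAST i. P i)"
    by (meson LeastI)
  define i where "i = (LEAST i. P i)"
  from P obtain A where A: "i > 0" "A \<in> c" "A \<in> M_lev \<mu> i"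
    unfolding P_def i_def by blast
  have "(A, B) \<notin> mat_equiv \<mu>" if "d \<in> {1..<i}" "B \<in> M_lev \<mu> d" for d B
  proof
    assume "(A, B) \<in> mat_equiv \<mu>"
    then have "P d"
      using that Sigma_mu_class(1)[OF assms A(2)] by (auto simp: P_def)
    then show False
      using that not_less_Least[of d P] by (simp add: i_def)
  qed
  then have "A \<in> primitive_mats \<mu> i"
    using A(3) by (simp add: primitive_mats_def)
  then show ?thesis
    using that A by blast
qed

section \<open>Matrices as vectors\<close>

text \<open>The space sits in a product of infinitely many lines, but its points vanish from
  coordinate \<open>n\<close> on, so boxes in the first \<open>n\<close> coordinates suffice. This
  form matches \<open>mat_open\<close>.\<close>

lemma openin_Euclidean_space_iff:
  "openin (Euclidean_space n) U \<longleftrightarrow> U \<subseteq> topspace (Euclidean_space n) \<and>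
     (\<forall>x\<in>U. \<exists>e>0. \<forall>y\<in>topspace (Euclidean_space n). (\<forall>k<n. \<bar>x k - y k\<bar> < e) \<longrightarrow> y \<in> U)"
proof (intro iffI conjI ballI)
  assume U: "openin (Euclidean_space n) U"
  then show sub: "U \<subseteq> topspace (Euclidean_space n)"
    by (rule openin_subset)
  fix x assume x: "x \<in> U"
  obtain T where T: "openin (powertop_real UNIV) T" and UT: "U = T \<inter> topspace (Euclidean_space n)"
    using U by (auto simp: Euclidean_space_def openin_subtopology)
  obtain X where X: "x \<in> (\<Pi>\<^sub>E i\<in>UNIV. X i)" "\<And>i. open (X i)" "(\<Pi>\<^sub>E i\<in>UNIV. X i) \<subseteq> T"
    using product_topology_open_contains_basis[OF T, of x] x UT by auto
  have "\<exists>e>0. \<forall>z. \<bar>x k - z\<bar> < e \<longrightarrow> z \<in> X k" for k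
  proof -
    have "x k \<in> X k"
      using X(1) by auto
    then show ?thesis
      using X(2)[of k] unfolding open_dist by (metis dist_real_def abs_minus_commute)
  qed
  then obtain e where e: "\<And>k. e k > 0" "\<And>k z. \<bar>x k - z\<bar> < e k \<Longrightarrow> z \<in> X k"
    by metis
  \<comment> \<open>The inserted 1 keeps the set nonempty when \<open>n = 0\<close>.\<close>
  define d where "d = Min (insert 1 (e ` {..<n}))"
  have d: "d > 0" "\<And>k. k < n \<Longrightarrow> d \<le> e k"
    using e(1) by (auto simp: d_def)
  have "y \<in> U" if y: "y \<in> topspace (Euclidean_space n)" and cl: "\<forall>k<n. \<bar>x k - y k\<bar> < d" for y
  proof -
    have "y k \<in> X k" for k
    proof (cases "k < n")
      case True
      then show ?thesis
        using cl d(2)[of k] by (intro e(2)) force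
    next
      case False
      then have "\<bar>x k - y k\<bar> = 0"
        using y x sub by (auto simp: topspace_Euclidean_space)
      then show ?thesis
        using e(1)[of k] by (intro e(2)) simp
    qed
    then show ?thesis
      using X(3) y UT by auto
  qed
  then show "\<exists>e>0. \<forall>y\<in>topspace (Euclidean_space n). (\<forall>k<n. \<bar>x k - y k\<bar> < e) \<longrightarrow> y \<in> U"
    using d(1) by blast
next
  assume R: "U \<subseteq> topspace (Euclidean_space n) \<and>
     (\<forall>x\<in>U. \<exists>e>0. \<forall>y\<in>topspace (Euclidean_space n). (\<forall>k<n. \<bar>x k - y k\<bar> < e) \<longrightarrow> y \<in> U)"
  show "openin (Euclidean_space n) U"
  proof (subst openin_subopen, intro ballI)
    fix x assume x: "x \<in> U"
    then obtain e where e: "e > 0"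
      "\<And>y. y \<in> topspace (Euclidean_space n) \<Longrightarrow> (\<forall>k<n. \<bar>x k - y k\<bar> < e) \<Longrightarrow> y \<in> U"
      using R by blast
    \<comment> \<open>Unrestricted factors from \<open>n\<close> on leave finitely many constraints,
      as a basic open box of the product requires.\<close>
    define X where "X k = (if k < n then {z. \<bar>x k - z\<bar> < e} else UNIV)" for k
    have "open {z. \<bar>y - z\<bar> < e}" for y :: real
      using open_ball[of y e] by (simp add: ball_def dist_real_def)
    then have "openin (powertop_real UNIV) (\<Pi>\<^sub>E i\<in>UNIV. X i)"
      by (intro product_topology_basis) (auto simp: X_def intro: finite_subset[of _ "{..<n}"])
    then have "openin (Euclidean_space n) ((\<Pi>\<^sub>E i\<in>UNIV. X i) \<inter> topspace (Euclidean_space n))"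
      by (auto simp: Euclidean_space_def openin_subtopology)
    moreover have "x \<in> (\<Pi>\<^sub>E i\<in>UNIV. X i) \<inter> topspace (Euclidean_space n)"
      using x R e(1) by (auto simp: X_def)
    moreover have "(\<Pi>\<^sub>E i\<in>UNIV. X i) \<inter> topspace (Euclidean_space n) \<subseteq> U"
    proof
      fix y assume y: "y \<in> (\<Pi>\<^sub>E i\<in>UNIV. X i) \<inter> topspace (Euclidean_space n)"
      have "\<bar>x k - y k\<bar> < e" if "k < n" for k
      proof -
        have "y k \<in> X k"
          using y by auto
        then show ?thesis
          using that by (simp add: X_def)
      qed
      then show "y \<in> U"
        using e(2) y by blast
    qed
    ultimately show "\<exists>T. openin (Euclidean_space n) T \<and> x \<in> T \<and> T \<subseteq> U"
      by blast
  qed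
qed

text \<open>Row-major order; the zero tail places the vector in
  \<open>Euclidean_space (m * n)\<close>.\<close>

definition entry_vec :: "nat \<Rightarrow> nat \<Rightarrow> real mat \<Rightarrow> nat \<Rightarrow> real" where
  "entry_vec m n A k = (if k < m * n then A $$ (k div n, k mod n) else 0)"

definition vec_mat :: "nat \<Rightarrow> nat \<Rightarrow> (nat \<Rightarrow> real) \<Rightarrow> real mat" where
  "vec_mat m n v = Matrix.mat m n (\<lambda>(p, q). v (p * n + q))"

lemma div_mod_less:
  fixes k m n :: nat
  assumes "k < m * n"
  shows "k div n < m" "k mod n < n"
  using assms by (cases "n = 0"; simp add: less_mult_imp_div_less)+

lemma mult_add_less_mult:
  fixes p q m n :: nat
  assumes "p < m" "q < n"
  shows "p * n + q < m * n"
proof -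
  have "p * n + q < Suc p * n"
    using assms by simp
  also have "\<dots> \<le> m * n"
    using assms by (intro mult_le_mono1) simp
  finally show ?thesis .
qed

lemma vec_mat_carrier [simp]: "vec_mat m n v \<in> carrier_mat m n"
  by (simp add: vec_mat_def)

lemma entry_vec_topspace: "entry_vec m n A \<in> topspace (Euclidean_space (m * n))"
  by (auto simp: topspace_Euclidean_space entry_vec_def)

lemma vec_mat_entry_vec:
  assumes "A \<in> carrier_mat m n"
  shows "vec_mat m n (entry_vec m n A) = A"
  using assms by (intro eq_matI) (auto simp: vec_mat_def entry_vec_def mult_add_less_mult)

lemma entry_vec_vec_mat:
  assumes "v \<in> topspace (Euclidean_space (m * n))"
  shows "entry_vec m n (vec_mat m n v) = v"
  using assms by (auto simp: fun_eq_iff topspace_Euclidean_space vec_mat_def entry_vec_def div_mod_less)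

text \<open>Rearranging entries preserves maximum distances, so \<open>e\<close> can be
  kept.\<close>

lemma openin_entry_vec_image:
  assumes W: "mat_open m n W"
  shows "openin (Euclidean_space (m * n)) (entry_vec m n ` W)"
  unfolding openin_Euclidean_space_iff
proof (intro conjI ballI)
  show "entry_vec m n ` W \<subseteq> topspace (Euclidean_space (m * n))"
    using entry_vec_topspace by blast
  fix x assume "x \<in> entry_vec m n ` W"
  then obtain A where A: "A \<in> W" "x = entry_vec m n A"
    by blast
  obtain e where e: "e > 0" "\<And>B. B \<in> carrier_mat m n \<Longrightarrow>
      (\<And>p q. p < m \<Longrightarrow> q < n \<Longrightarrow> \<bar>A $$ (p, q) - B $$ (p, q)\<bar> < e) \<Longrightarrow> B \<in> W"
    using mat_openD[OF W A(1)] by metis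
  have "y \<in> entry_vec m n ` W"
    if y: "y \<in> topspace (Euclidean_space (m * n))" and cl: "\<forall>k<m * n. \<bar>x k - y k\<bar> < e" for y
  proof -
    have "vec_mat m n y \<in> W"
    proof (rule e(2))
      fix p q assume pq: "p < m" "q < n"
      then show "\<bar>A $$ (p, q) - vec_mat m n y $$ (p, q)\<bar> < e"
        using cl mult_add_less_mult[OF pq] by (auto simp: A(2) entry_vec_def vec_mat_def)
    qed simp
    then show ?thesis
      using entry_vec_vec_mat[OF y] by (metis image_eqI)
  qed
  then show "\<exists>e>0. \<forall>y\<in>topspace (Euclidean_space (m * n)).
      (\<forall>k<m * n. \<bar>x k - y k\<bar> < e) \<longrightarrow> y \<in> entry_vec m n ` W"
    using e(1) by blast
qed

lemma mat_open_entry_vec_vimage: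
  assumes U: "openin (Euclidean_space (m * n)) U"
  shows "mat_open m n {A \<in> carrier_mat m n. entry_vec m n A \<in> U}"
  unfolding mat_open_def
proof (intro conjI ballI)
  fix A assume "A \<in> {A \<in> carrier_mat m n. entry_vec m n A \<in> U}"
  then obtain e where e: "e > 0" "\<And>y. y \<in> topspace (Euclidean_space (m * n)) \<Longrightarrow>
      (\<forall>k<m * n. \<bar>entry_vec m n A k - y k\<bar> < e) \<Longrightarrow> y \<in> U"
    using U unfolding openin_Euclidean_space_iff by blast
  have "entry_vec m n B \<in> U" if "\<forall>p<m. \<forall>q<n. \<bar>A $$ (p, q) - B $$ (p, q)\<bar> < e" for B
    using that by (intro e(2) entry_vec_topspace) (auto simp: entry_vec_def div_mod_less)
  then show "\<exists>e>0. \<forall>B\<in>carrier_mat m n. (\<forall>p<m. \<forall>q<n. \<bar>A $$ (p, q) - B $$ (p, q)\<bar> < e) \<longrightarrow>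
      B \<in> {A \<in> carrier_mat m n. entry_vec m n A \<in> U}"
    using e(1) by blast
qed auto

section \<open>Charts\<close>

text \<open>The value is unspecified for classes without a matrix of level \<open>i\<close>; these
  lie outside the domain of \<open>stratum_chart\<close>.\<close>

definition level_rep :: "rat \<Rightarrow> nat \<Rightarrow> real mat set \<Rightarrow> real mat" where
  "level_rep \<mu> i c = (THE A. A \<in> c \<and> A \<in> M_lev \<mu> i)"

lemma level_rep_eq:
  assumes "\<mu> > 0" "i > 0" "c \<in> Sigma_mu \<mu>" "A \<in> c" "A \<in> M_lev \<mu> i"
  shows "level_rep \<mu> i c = A"
  unfolding level_rep_def using assms Sigma_mu_rep_unique by (intro the_equality) blast+

definition stratum_chart :: "rat \<Rightarrow> nat \<Rightarrow> real mat set chart" where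
  "stratum_chart \<mu> i =
     \<lparr>chart_dim = (i * mu_y \<mu>) * (i * mu_x \<mu>),
      chart_dom = sub_basic \<mu> (primitive_mats \<mu> i),
      chart_map = (\<lambda>c. entry_vec (i * mu_y \<mu>) (i * mu_x \<mu>) (level_rep \<mu> i c))\<rparr>"

text \<open>Gives continuity of the map from primitive matrices to their classes. At level
  \<open>j\<close> the class of \<open>A\<close> offers a single candidate for membership in
  \<open>W\<close>, and none unless \<open>i\<close> divides \<open>j\<close>.\<close>

lemma stratum_vimage_sub_basic:
  assumes \<mu>: "\<mu> > 0" and i: "i > 0" and j: "j > 0" and W: "mat_open (j * mu_y \<mu>) (j * mu_x \<mu>) W"
  shows "mat_open (i * mu_y \<mu>) (i * mu_x \<mu>)
    {A \<in> primitive_mats \<mu> i. mat_equiv \<mu> `` {A} \<in> sub_basic \<mu> W}"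
proof -
  have W_lev: "W \<subseteq> M_lev \<mu> j"
    using W by (simp add: mat_open_def M_lev_def)
  have iff: "mat_equiv \<mu> `` {A} \<in> sub_basic \<mu> W \<longleftrightarrow> i dvd j \<and> inflate A (j div i) \<in> W"
    if A: "A \<in> primitive_mats \<mu> i" for A
  proof -
    have "A \<in> M_all \<mu>"
      using A primitive_mats_subset M_lev_imp_M_all[OF i] by blast
    then have "mat_equiv \<mu> `` {A} \<in> sub_basic \<mu> W \<longleftrightarrow> (\<exists>B\<in>W. (A, B) \<in> mat_equiv \<mu>)"
      using class_in_Sigma_mu by (auto simp: sub_basic_def)
    also have "\<dots> \<longleftrightarrow> (\<exists>B\<in>W. i dvd j \<and> B = inflate A (j div i))"
      using primitive_equiv_iff[OF \<mu> i A j] W_lev by blast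
    finally show ?thesis
      by blast
  qed
  show ?thesis
  proof (cases "i dvd j")
    case True
    then obtain k where k: "j = i * k"
      by blast
    have "mat_open (i * mu_y \<mu>) (i * mu_x \<mu>)
        {A \<in> carrier_mat (i * mu_y \<mu>) (i * mu_x \<mu>). inflate A k \<in> W}"
      using W j k by (intro mat_open_inflate_vimage) (simp_all add: ac_simps)
    then have "mat_open (i * mu_y \<mu>) (i * mu_x \<mu>) (primitive_mats \<mu> i \<inter>
        {A \<in> carrier_mat (i * mu_y \<mu>) (i * mu_x \<mu>). inflate A k \<in> W})"
      by (intro mat_open_Int mat_open_primitive_mats \<mu> i)
    moreover have "primitive_mats \<mu> i \<inter>
        {A \<in> carrier_mat (i * mu_y \<mu>) (i * mu_x \<mu>). inflate A k \<in> W} =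
      {A \<in> primitive_mats \<mu> i. mat_equiv \<mu> `` {A} \<in> sub_basic \<mu> W}"
      using iff k i primitive_mats_subset[of \<mu> i] by (auto simp: M_lev_def)
    ultimately show ?thesis
      by simp
  next
    case False
    then have "{A \<in> primitive_mats \<mu> i. mat_equiv \<mu> `` {A} \<in> sub_basic \<mu> W} = {}"
      using iff by blast
    then show ?thesis
      by (simp only: mat_open_empty)
  qed
qed

lemma simple_chart_stratum:
  assumes \<mu>: "\<mu> > 0" and i: "i > 0" and ne: "sub_basic \<mu> (primitive_mats \<mu> i) \<noteq> {}"
  shows "simple_chart (Sigma_top \<mu>) (stratum_chart \<mu> i)"
proof -
  define m n where "m = i * mu_y \<mu>" and "n = i * mu_x \<mu>"
  define P where "P = primitive_mats \<mu> i"
  define D where "D = sub_basic \<mu> P"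
  define f where "f c = entry_vec m n (level_rep \<mu> i c)" for c
  define g where "g v = mat_equiv \<mu> `` {vec_mat m n v}" for v
  define \<Theta> where "\<Theta> = entry_vec m n ` P"
  have P: "mat_open m n P"
    unfolding P_def m_def n_def by (rule mat_open_primitive_mats[OF \<mu> i])
  have P_lev: "A \<in> M_lev \<mu> i" "A \<in> carrier_mat m n" "A \<in> M_all \<mu>" if "A \<in> P" for A
    using that primitive_mats_subset[of \<mu> i] M_lev_imp_M_all[OF i]
    unfolding P_def m_def n_def M_lev_def by blast+
  have X_D: "openin (Sigma_top \<mu>) D"
    using P openin_sub_basic[OF i] by (simp add: D_def m_def n_def)
  then have topD: "topspace (subtopology (Sigma_top \<mu>) D) = D"
    by (intro topspace_subtopology_subset openin_subset)
  have \<Theta>: "openin (Euclidean_space (m * n)) \<Theta>"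
    unfolding \<Theta>_def by (rule openin_entry_vec_image[OF P])
  then have top\<Theta>: "topspace (subtopology (Euclidean_space (m * n)) \<Theta>) = \<Theta>"
    by (intro topspace_subtopology_subset openin_subset)
  have D_rep: "\<exists>A\<in>P. c = mat_equiv \<mu> `` {A} \<and> level_rep \<mu> i c = A" if "c \<in> D" for c
  proof -
    obtain A where A: "c \<in> Sigma_mu \<mu>" "A \<in> c" "A \<in> P"
      using \<open>c \<in> D\<close> by (auto simp: D_def sub_basic_def)
    then show ?thesis
      using Sigma_mu_class(1)[OF A(1,2)] level_rep_eq[OF \<mu> i A(1,2)] P_lev(1) by blast
  qed
  have class_D: "mat_equiv \<mu> `` {A} \<in> D" if "A \<in> P" for A
    using that P_lev(3) class_in_Sigma_mu class_self unfolding D_def sub_basic_def by blast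
  have rep_class: "level_rep \<mu> i (mat_equiv \<mu> `` {A}) = A" if "A \<in> P" for A
    using that P_lev class_in_Sigma_mu class_self level_rep_eq[OF \<mu> i] by blast
  have g_entry_vec: "g (entry_vec m n A) = mat_equiv \<mu> `` {A}" if "A \<in> P" for A
    by (simp add: g_def vec_mat_entry_vec P_lev(2)[OF that])
  have "homeomorphic_maps (subtopology (Sigma_top \<mu>) D)
      (subtopology (Euclidean_space (m * n)) \<Theta>) f g"
    unfolding homeomorphic_maps_def topD top\<Theta>
  proof (intro conjI ballI)
    show "g (f c) = c" if "c \<in> D" for c
      using D_rep[OF that] g_entry_vec by (auto simp: f_def)
    show "f (g v) = v" if "v \<in> \<Theta>" for v
      using that g_entry_vec rep_class by (auto simp: \<Theta>_def f_def)
    show "continuous_map (subtopology (Sigma_top \<mu>) D) (subtopology (Euclidean_space (m * n)) \<Theta>) f"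
      unfolding continuous_map_def topD top\<Theta>
    proof (intro conjI allI impI)
      show "f \<in> D \<rightarrow> \<Theta>"
        using D_rep by (fastforce simp: f_def \<Theta>_def)
      fix U assume "openin (subtopology (Euclidean_space (m * n)) \<Theta>) U"
      then have U: "openin (Euclidean_space (m * n)) U"
        using \<Theta> by (simp add: openin_open_subtopology)
      \<comment> \<open>Matrices of level \<open>i\<close> alone describe the preimage of
        \<open>U\<close>: intersecting with \<open>P\<close> keeps the classes in the stratum, and
        uniqueness of representatives identifies the member of \<open>?W\<close> with the
        coordinate.\<close>
      let ?W = "P \<inter> {A \<in> carrier_mat m n. entry_vec m n A \<in> U}"
      have "mat_open m n ?W"
        by (intro mat_open_Int P mat_open_entry_vec_vimage U)
      then have "openin (Sigma_top \<mu>) (sub_basic \<mu> ?W)"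
        using openin_sub_basic[OF i] by (simp add: m_def n_def)
      moreover have "{c \<in> D. f c \<in> U} = sub_basic \<mu> ?W"
      proof (intro subset_antisym subsetI)
        fix c assume c: "c \<in> {c \<in> D. f c \<in> U}"
        then obtain A where A: "A \<in> P" "c = mat_equiv \<mu> `` {A}" "level_rep \<mu> i c = A"
          using D_rep by blast
        then have "A \<in> ?W" "A \<in> c" "c \<in> Sigma_mu \<mu>"
          using c P_lev class_self class_in_Sigma_mu by (auto simp: f_def)
        then show "c \<in> sub_basic \<mu> ?W"
          unfolding sub_basic_def by blast
      next
        fix c assume "c \<in> sub_basic \<mu> ?W"
        then obtain A where A: "c \<in> Sigma_mu \<mu>" "A \<in> c" "A \<in> ?W"
          by (auto simp: sub_basic_def)
        then have "level_rep \<mu> i c = A" "c \<in> D"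
          using level_rep_eq[OF \<mu> i A(1,2)] P_lev(1) unfolding D_def sub_basic_def by blast+
        then show "c \<in> {c \<in> D. f c \<in> U}"
          using A(3) by (simp add: f_def)
      qed
      ultimately show "openin (subtopology (Sigma_top \<mu>) D) {c \<in> D. f c \<in> U}"
        using X_D by (auto simp: openin_open_subtopology)
    qed
    have g\<Theta>: "g v \<in> D" if "v \<in> \<Theta>" for v
      using that g_entry_vec class_D by (auto simp: \<Theta>_def)
    \<comment> \<open>Continuity into the generated topology need only be tested on its sub-basis,
      so the restriction of the target to \<open>D\<close> is postponed.\<close>
    have "continuous_map (subtopology (Euclidean_space (m * n)) \<Theta>) (Sigma_top \<mu>) g"
      unfolding Sigma_top_def
    proof (rule continuous_on_generated_topo, unfold top\<Theta>)
      fix U assume "U \<in> {sub_basic \<mu> (M_ball \<mu> i A r) | i A r.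
        i \<ge> 1 \<and> A \<in> M_lev \<mu> i \<and> elements_mat A \<subseteq> \<rat> \<and> r \<in> \<rat> \<and> r > 0}"
      then obtain j B r where j: "j > 0" "B \<in> M_lev \<mu> j" and U: "U = sub_basic \<mu> (M_ball \<mu> j B r)"
        by (auto simp: Suc_le_eq)
      let ?W = "{A \<in> P. mat_equiv \<mu> `` {A} \<in> U}"
      have "mat_open m n ?W"
        unfolding U m_def n_def P_def
        by (rule stratum_vimage_sub_basic[OF \<mu> i j(1) mat_open_M_ball[OF j(2)]])
      then have "openin (Euclidean_space (m * n)) (entry_vec m n ` ?W)"
        by (rule openin_entry_vec_image)
      moreover have "g -` U \<inter> \<Theta> = entry_vec m n ` ?W"
        using g_entry_vec by (auto simp: \<Theta>_def)
      moreover have "entry_vec m n ` ?W \<subseteq> \<Theta>"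
        by (auto simp: \<Theta>_def)
      ultimately show "openin (subtopology (Euclidean_space (m * n)) \<Theta>) (g -` U \<inter> \<Theta>)"
        using \<Theta> by (simp add: openin_open_subtopology)
    next
      show "g ` \<Theta> \<subseteq> \<Union>{sub_basic \<mu> (M_ball \<mu> i A r) | i A r.
        i \<ge> 1 \<and> A \<in> M_lev \<mu> i \<and> elements_mat A \<subseteq> \<rat> \<and> r \<in> \<rat> \<and> r > 0}"
        using g\<Theta> openin_subset[OF X_D] by (auto simp: Sigma_top_def)
    qed
    then show "continuous_map (subtopology (Euclidean_space (m * n)) \<Theta>) (subtopology (Sigma_top \<mu>) D) g"
      using g\<Theta> by (auto simp: continuous_map_in_subtopology top\<Theta>)
  qed
  then have "homeomorphic_map (subtopology (Sigma_top \<mu>) D)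
      (subtopology (Euclidean_space (m * n)) \<Theta>) f"
    using homeomorphic_map_maps by blast
  moreover have "stratum_chart \<mu> i = \<lparr>chart_dim = m * n, chart_dom = D, chart_map = f\<rparr>"
    by (simp add: stratum_chart_def m_def n_def D_def P_def f_def[abs_def])
  ultimately show ?thesis
    using ne X_D \<Theta> by (auto simp: simple_chart_def D_def P_def)
qed

section \<open>The separation and countability axioms\<close>

text \<open>At the common level \<open>i * j\<close> equivalence is equality, so representatives of
  distinct classes differ there in some entry. A class close to both would have one and the same
  value at this entry.\<close>

lemma Hausdorff_Sigma_top:
  assumes \<mu>: "\<mu> > 0"
  shows "Hausdorff_space (Sigma_top \<mu>)"
  unfolding Hausdorff_space_def topspace_Sigma_top
proof (intro allI impI, elim conjE)
  fix c d assume c: "c \<in> Sigma_mu \<mu>" and d: "d \<in> Sigma_mu \<mu>" and cd: "c \<noteq> d"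
  obtain i A where "i > 0" "A \<in> primitive_mats \<mu> i" "A \<in> c"
    by (rule Sigma_mu_primitive_rep[OF c])
  then have i: "i > 0" "A \<in> M_lev \<mu> i" "A \<in> c"
    using primitive_mats_subset by blast+
  obtain j B where "j > 0" "B \<in> primitive_mats \<mu> j" "B \<in> d"
    by (rule Sigma_mu_primitive_rep[OF d])
  then have j: "j > 0" "B \<in> M_lev \<mu> j" "B \<in> d"
    using primitive_mats_subset by blast+
  let ?m = "i * mu_y \<mu> * j" and ?n = "i * mu_x \<mu> * j"
  have iA: "inflate A j \<in> carrier_mat ?m ?n" and jB: "inflate B i \<in> carrier_mat ?m ?n"
    using i(2) j(2) by (auto simp: M_lev_def)
  have "(A, B) \<notin> mat_equiv \<mu>"
  proof
    assume "(A, B) \<in> mat_equiv \<mu>"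
    then have "mat_equiv \<mu> `` {A} = mat_equiv \<mu> `` {B}"
      by (rule equiv_class_eq[OF equiv_mat_equiv])
    then show False
      using cd Sigma_mu_class(1)[OF c i(3)] Sigma_mu_class(1)[OF d j(3)] by simp
  qed
  then have "inflate A j \<noteq> inflate B i"
    using mat_equiv_iff[OF \<mu> i(1,2) j(1,2)] by simp
  then obtain p q where p: "p < ?m" and q: "q < ?n" and ne: "inflate A j $$ (p, q) \<noteq> inflate B i $$ (p, q)"
    using iA jB by (metis carrier_matD eq_matI)
  \<comment> \<open>Half the gap, so that no number is within \<open>e\<close> of both
    entries.\<close>
  define e where "e = \<bar>inflate A j $$ (p, q) - inflate B i $$ (p, q)\<bar> / 2"
  have e: "e > 0"
    using ne by (simp add: e_def)
  \<comment> \<open>The condition concerns an entry of the inflation, but is pulled back to the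
    level of the representative, where \<open>openin_sub_basic\<close> applies.\<close>
  define near where "near m n k C =
    {C' \<in> carrier_mat m n. inflate C' k \<in> {E \<in> carrier_mat ?m ?n. \<bar>C $$ (p, q) - E $$ (p, q)\<bar> < e}}"
    for m n k :: nat and C :: "real mat"
  have target_open: "mat_open ?m ?n {E \<in> carrier_mat ?m ?n. \<bar>C $$ (p, q) - E $$ (p, q)\<bar> < e}" for C :: "real mat"
    unfolding mat_open_def
  proof (intro conjI ballI)
    fix E assume "E \<in> {E \<in> carrier_mat ?m ?n. \<bar>C $$ (p, q) - E $$ (p, q)\<bar> < e}"
    then have E: "e - \<bar>C $$ (p, q) - E $$ (p, q)\<bar> > 0"
      by simp
    have "F \<in> {E \<in> carrier_mat ?m ?n. \<bar>C $$ (p, q) - E $$ (p, q)\<bar> < e}"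
      if F: "F \<in> carrier_mat ?m ?n"
        "\<forall>k<?m. \<forall>l<?n. \<bar>E $$ (k, l) - F $$ (k, l)\<bar> < e - \<bar>C $$ (p, q) - E $$ (p, q)\<bar>" for F
    proof -
      have "\<bar>E $$ (p, q) - F $$ (p, q)\<bar> < e - \<bar>C $$ (p, q) - E $$ (p, q)\<bar>"
        using F(2) p q by blast
      then show ?thesis
        using F(1) by auto
    qed
    then show "\<exists>r>0. \<forall>F\<in>carrier_mat ?m ?n. (\<forall>p<?m. \<forall>q<?n. \<bar>E $$ (p, q) - F $$ (p, q)\<bar> < r) \<longrightarrow>
        F \<in> {E \<in> carrier_mat ?m ?n. \<bar>C $$ (p, q) - E $$ (p, q)\<bar> < e}"
      using E by blast
  qed auto
  have near_open: "mat_open m n (near m n k C)" if "k > 0" "m * k = ?m" "n * k = ?n" for m n k C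
    unfolding near_def by (rule mat_open_inflate_vimage[OF that(1)]) (simp only: that(2,3) target_open)
  let ?U = "near (i * mu_y \<mu>) (i * mu_x \<mu>) j (inflate A j)"
  let ?V = "near (j * mu_y \<mu>) (j * mu_x \<mu>) i (inflate B i)"
  have U: "openin (Sigma_top \<mu>) (sub_basic \<mu> ?U)" and V: "openin (Sigma_top \<mu>) (sub_basic \<mu> ?V)"
    using i(1) j(1) by (intro openin_sub_basic near_open; simp)+
  have "A \<in> ?U" "B \<in> ?V"
    using i(2) j(2) iA jB e by (auto simp: near_def M_lev_def)
  then have cU: "c \<in> sub_basic \<mu> ?U" and dV: "d \<in> sub_basic \<mu> ?V"
    using c d i(3) j(3) unfolding sub_basic_def by blast+
  have "disjnt (sub_basic \<mu> ?U) (sub_basic \<mu> ?V)"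
    unfolding disjnt_iff
  proof (intro allI notI, elim conjE)
    fix x assume "x \<in> sub_basic \<mu> ?U" "x \<in> sub_basic \<mu> ?V"
    then obtain A' B' where x: "x \<in> Sigma_mu \<mu>" and A': "A' \<in> x" "A' \<in> ?U" and B': "B' \<in> x" "B' \<in> ?V"
      unfolding sub_basic_def by blast
    have lev: "A' \<in> M_lev \<mu> i" "B' \<in> M_lev \<mu> j"
      using A'(2) B'(2) by (auto simp: near_def M_lev_def)
    have "(A', B') \<in> mat_equiv \<mu>"
      using Sigma_mu_class(1)[OF x A'(1)] B'(1) by blast
    then have eq: "inflate A' j = inflate B' i"
      using mat_equiv_iff[OF \<mu> i(1) lev(1) j(1) lev(2)] by simp
    have "\<bar>inflate A j $$ (p, q) - inflate A' j $$ (p, q)\<bar> < e"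
      "\<bar>inflate B i $$ (p, q) - inflate A' j $$ (p, q)\<bar> < e"
      using A'(2) B'(2) by (simp_all add: near_def flip: eq)
    then show False
      unfolding e_def by (simp add: abs_if split: if_splits)
  qed
  then show "\<exists>U V. openin (Sigma_top \<mu>) U \<and> openin (Sigma_top \<mu>) V \<and> c \<in> U \<and> d \<in> V \<and> disjnt U V"
    using U V cU dV by blast
qed

text \<open>Finite intersections of generators form a countable base, by induction on how an open
  set is generated.\<close>

lemma second_countable_topology_generated_by:
  assumes "countable S"
  shows "second_countable (topology_generated_by S)"
proof -
  \<comment> \<open>Empty families are left out: their intersection is the whole type, which need
    not be open here.\<close>
  define \<B> where "\<B> = {\<Inter>F | F. finite F \<and> F \<subseteq> S \<and> F \<noteq> {}}"
  have "countable \<B>"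
  proof -
    have "countable {F. finite F \<and> F \<subseteq> S}"
      using assms by (rule countable_Collect_finite_subset)
    then have "countable (Inter ` {F. finite F \<and> F \<subseteq> S})"
      by (rule countable_image)
    then show ?thesis
      by (rule countable_subset[rotated]) (auto simp: \<B>_def)
  qed
  moreover have "openin (topology_generated_by S) V" if "V \<in> \<B>" for V
  proof -
    obtain F where F: "V = \<Inter>F" "finite F" "F \<subseteq> S" "F \<noteq> {}"
      using \<open>V \<in> \<B>\<close> unfolding \<B>_def by blast
    show ?thesis
      unfolding F(1) by (rule openin_Inter[OF F(2,4)]) (use F(3) topology_generated_by_Basis in blast)
  qed
  moreover have "\<exists>V\<in>\<B>. x \<in> V \<and> V \<subseteq> U" if "generate_topology_on S U" "x \<in> U" for U x
    using that
  proof (induction arbitrary: x rule: generate_topology_on.induct)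
    case (Int a b)
    obtain V W where VW: "V \<in> \<B>" "x \<in> V" "V \<subseteq> a" "W \<in> \<B>" "x \<in> W" "W \<subseteq> b"
      using Int.IH Int.prems by blast
    obtain F where F: "V = \<Inter>F" "finite F" "F \<subseteq> S" "F \<noteq> {}"
      using VW(1) unfolding \<B>_def by blast
    obtain G where G: "W = \<Inter>G" "finite G" "G \<subseteq> S" "G \<noteq> {}"
      using VW(4) unfolding \<B>_def by blast
    have "V \<inter> W = \<Inter>(F \<union> G)" "finite (F \<union> G)" "F \<union> G \<subseteq> S" "F \<union> G \<noteq> {}"
      using F G by auto
    then have "V \<inter> W \<in> \<B>"
      unfolding \<B>_def by blast
    then show ?case
      using VW by (intro bexI[of _ "V \<inter> W"]) auto
  next
    case (UN K)
    then obtain k where "k \<in> K" "x \<in> k"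
      by blast
    then obtain V where "V \<in> \<B>" "x \<in> V" "V \<subseteq> k"
      using UN.IH by blast
    then show ?case
      using \<open>k \<in> K\<close> by (intro bexI[of _ V]) auto
  next
    case (Basis s)
    have "s \<in> \<B>"
      unfolding \<B>_def using Basis.hyps by (intro CollectI exI[of _ "{s}"]) simp
    then show ?case
      using Basis.prems by blast
  qed simp
  ultimately show ?thesis
    unfolding second_countable_def openin_topology_generated_by_iff by blast
qed

text \<open>A matrix of fixed shape is determined by the finite list of its entries, and there are
  countably many lists of rationals.\<close>

lemma countable_rational_matrices:
  "countable {A \<in> carrier_mat m n. elements_mat A \<subseteq> (\<rat> :: real set)}"
proof -
  let ?F = "{xs :: real list. set xs \<subseteq> \<rat>}"
  let ?h = "\<lambda>xs. Matrix.mat m n (\<lambda>(p, q). xs ! (p * n + q))"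
  have "countable (?h ` ?F)"
    using countable_lists[OF countable_rat] by (intro countable_image) (simp add: lists_eq_set)
  moreover have "{A \<in> carrier_mat m n. elements_mat A \<subseteq> \<rat>} \<subseteq> ?h ` ?F"
  proof
    fix A assume "A \<in> {A \<in> carrier_mat m n. elements_mat A \<subseteq> (\<rat> :: real set)}"
    then have A: "A \<in> carrier_mat m n" and "elements_mat A \<subseteq> \<rat>"
      by auto
    then have rat: "A $$ (p, q) \<in> \<rat>" if "p < m" "q < n" for p q
      using that elements_matI[OF A that] by blast
    let ?xs = "map (entry_vec m n A) [0..<m * n]"
    have xs: "?xs \<in> ?F"
      using rat by (auto simp: entry_vec_def div_mod_less)
    have "?h ?xs = vec_mat m n (entry_vec m n A)"
      by (intro eq_matI) (auto simp: vec_mat_def mult_add_less_mult)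
    also have "\<dots> = A"
      by (rule vec_mat_entry_vec[OF A])
    finally show "A \<in> ?h ` ?F"
      by (rule image_eqI[OF sym xs])
  qed
  ultimately show ?thesis
    by (rule countable_subset[rotated])
qed

lemma second_countable_Sigma_top: "second_countable (Sigma_top \<mu>)"
  unfolding Sigma_top_def
proof (rule second_countable_topology_generated_by)
  let ?Q = "\<lambda>i. {A \<in> M_lev \<mu> i. elements_mat A \<subseteq> \<rat>}"
  have "countable (?Q i \<times> \<rat>)" for i
    unfolding M_lev_def by (intro countable_SIGMA countable_rational_matrices countable_rat)
  then have "countable (\<Union>i. (\<lambda>(A, r). sub_basic \<mu> (M_ball \<mu> i A r)) ` (?Q i \<times> \<rat>))"
    by (intro countable_UN countable_image) auto
  then show "countable {sub_basic \<mu> (M_ball \<mu> i A r) | i A r.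
      i \<ge> 1 \<and> A \<in> M_lev \<mu> i \<and> elements_mat A \<subseteq> \<rat> \<and> r \<in> \<rat> \<and> r > 0}"
  proof (rule countable_subset[rotated], intro subsetI)
    fix U assume "U \<in> {sub_basic \<mu> (M_ball \<mu> i A r) | i A r.
      i \<ge> 1 \<and> A \<in> M_lev \<mu> i \<and> elements_mat A \<subseteq> \<rat> \<and> r \<in> \<rat> \<and> r > 0}"
    then obtain i A r where "U = sub_basic \<mu> (M_ball \<mu> i A r)" "(A, r) \<in> ?Q i \<times> \<rat>"
      by blast
    then show "U \<in> (\<Union>i. (\<lambda>(A, r). sub_basic \<mu> (M_ball \<mu> i A r)) ` (?Q i \<times> \<rat>))"
      by (intro UN_I[of i] image_eqI[of _ _ "(A, r)"]) auto
  qed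
qed

section \<open>The atlas\<close>

text \<open>Coordinate \<open>j\<close> has the two-term expansion \<open>a j + (x j - a j)\<close>
  around \<open>a\<close>, carried by the zero multi-index and the unit multi-index
  \<open>u\<close>. It is exact on all of \<open>W\<close>, so the radius is arbitrary.\<close>

lemma real_analytic_map_id_on:
  assumes "\<And>x. x \<in> W \<Longrightarrow> f x = x"
  shows "real_analytic_map n n W f"
  unfolding real_analytic_map_def
proof (intro ballI allI impI)
  fix a j assume a: "a \<in> W" and j: "j < n"
  define u :: "nat \<Rightarrow> nat" where "u = (\<lambda>i. if i = j then 1 else 0)"
  define c :: "(nat \<Rightarrow> nat) \<Rightarrow> real" where "c \<alpha> = (if \<alpha> = u then 1 else if \<alpha> = (\<lambda>_. 0) then a j else 0)" for \<alpha>
  have u0: "u \<noteq> (\<lambda>_. 0)"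
    by (auto simp: u_def fun_eq_iff)
  have "((\<lambda>\<alpha>. c \<alpha> * (\<Prod>i<n. (x i - a i) ^ \<alpha> i)) has_sum f x j) (multi_indices n)"
    if x: "x \<in> W" for x
  proof (rule has_sum_finite_neutralI[of "{u, \<lambda>_. 0}"])
    show "{u, \<lambda>_. 0} \<subseteq> multi_indices n"
      using j by (auto simp: multi_indices_def u_def)
    have "(\<Prod>i<n. (x i - a i) ^ u i) = (\<Prod>i<n. if i = j then x i - a i else 1)"
      by (intro prod.cong) (auto simp: u_def)
    also have "\<dots> = x j - a j"
      using j by simp
    finally show "f x j = (\<Sum>\<alpha>\<in>{u, \<lambda>_. 0}. c \<alpha> * (\<Prod>i<n. (x i - a i) ^ \<alpha> i))"
      using u0 assms[OF x] by (simp add: c_def)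
  qed (auto simp: c_def)
  then show "\<exists>c r. r > 0 \<and> (\<forall>x\<in>W. (\<forall>i<n. \<bar>x i - a i\<bar> < r) \<longrightarrow>
      ((\<lambda>\<alpha>. c \<alpha> * (\<Prod>i<n. (x i - a i) ^ \<alpha> i)) has_sum f x j) (multi_indices n))"
    by (intro exI[of _ c] exI[of _ 1]) simp
qed

lemma analytic_transition_refl: "analytic_transition u u"
  unfolding analytic_transition_def Int_absorb
  by (rule real_analytic_map_id_on) (simp add: transition_map_def f_inv_into_f)

lemma analytic_comparable_sym: "analytic_comparable B C \<Longrightarrow> analytic_comparable C B"
  unfolding analytic_comparable_def by metis

text \<open>Charts of one bundle have distinct dimensions, so only the transition of a chart to
  itself is to be checked.\<close>

lemma analytic_comparable_refl: "bundled_chart X B \<Longrightarrow> analytic_comparable B B"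
  unfolding analytic_comparable_def bundled_chart_def
  by (metis analytic_transition_refl inj_onD)

text \<open>
  Comparability is not transitive, so the charts comparable with all of \<open>\<C>\<close> need not form
  an atlas; Zorn's lemma provides a maximal one instead.
\<close>

lemma exists_maximal_atlas:
  assumes "\<forall>B\<in>\<C>. bundled_chart X B" "\<forall>B\<in>\<C>. \<forall>C\<in>\<C>. analytic_comparable B C"
  obtains \<M> where "\<C> \<subseteq> \<M>" "\<forall>B\<in>\<M>. bundled_chart X B" "\<forall>B\<in>\<M>. \<forall>C\<in>\<M>. analytic_comparable B C"
    "\<And>V. bundled_chart X V \<Longrightarrow> \<forall>B\<in>\<M>. analytic_comparable V B \<Longrightarrow> V \<in> \<M>"
proof -
  define \<A> where "\<A> = {\<M>. \<C> \<subseteq> \<M> \<and> (\<forall>B\<in>\<M>. bundled_chart X B) \<and>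
    (\<forall>B\<in>\<M>. \<forall>C\<in>\<M>. analytic_comparable B C)}"
  have "\<exists>M\<in>\<A>. \<forall>Z\<in>\<A>. M \<subseteq> Z \<longrightarrow> Z = M"
  proof (rule subset_Zorn_nonempty)
    show "\<A> \<noteq> {}"
      using assms by (auto simp: \<A>_def)
    fix K assume K: "K \<noteq> {}" "subset.chain \<A> K"
    then have sub: "K \<subseteq> \<A>" and tot: "\<And>Y Z. Y \<in> K \<Longrightarrow> Z \<in> K \<Longrightarrow> Y \<subseteq> Z \<or> Z \<subseteq> Y"
      by (auto simp: subset_chain_def)
    have "analytic_comparable B C" if BC: "B \<in> \<Union>K" "C \<in> \<Union>K" for B C
    proof -
      obtain Y Z where "Y \<in> K" "B \<in> Y" "Z \<in> K" "C \<in> Z"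
        using BC by blast
      \<comment> \<open>The larger of the two members of the chain contains both bundles.\<close>
      then obtain T where "T \<in> K" "B \<in> T" "C \<in> T"
        using tot by (meson subsetD)
      then show ?thesis
        using sub unfolding \<A>_def by blast
    qed
    moreover have "\<C> \<subseteq> \<Union>K"
      using K(1) sub unfolding \<A>_def by blast
    moreover have "bundled_chart X B" if "B \<in> \<Union>K" for B
      using that sub unfolding \<A>_def by blast
    ultimately show "\<Union>K \<in> \<A>"
      unfolding \<A>_def by (intro CollectI conjI ballI)
  qed
  then obtain \<M> where "\<M> \<in> \<A>" and max: "\<And>Z. Z \<in> \<A> \<Longrightarrow> \<M> \<subseteq> Z \<Longrightarrow> Z = \<M>"
    by blast
  then have \<M>: "\<C> \<subseteq> \<M>" "\<forall>B\<in>\<M>. bundled_chart X B" "\<forall>B\<in>\<M>. \<forall>C\<in>\<M>. analytic_comparable B C"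
    by (simp_all add: \<A>_def)
  have "V \<in> \<M>" if V: "bundled_chart X V" "\<forall>B\<in>\<M>. analytic_comparable V B" for V
  proof -
    \<comment> \<open>The enlarged atlas must also compare \<open>V\<close> with itself, which its
      membership in no atlas yet provides.\<close>
    have "insert V \<M> \<in> \<A>"
      using \<M> V analytic_comparable_refl[OF V(1)]
      by (simp add: \<A>_def subset_insertI2 analytic_comparable_sym)
    then show ?thesis
      using max by blast
  qed
  then show ?thesis
    by (rule that[OF \<M>])
qed

lemma stratum_chart_dim_inject:
  assumes "\<mu> > 0" and eq: "chart_dim (stratum_chart \<mu> i) = chart_dim (stratum_chart \<mu> j)"
  shows "i = j"
proof -
  have "(mu_y \<mu> * mu_x \<mu>) * i\<^sup>2 = (mu_y \<mu> * mu_x \<mu>) * j\<^sup>2"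
    using eq by (simp add: stratum_chart_def power2_eq_square ac_simps)
  then show ?thesis
    using mu_y_mu_x[OF assms(1)] by simp
qed

theorem theorem102:
  fixes \<mu> :: rat
  assumes "\<mu> > 0"
  shows "bundled_analytic_manifold (Sigma_top \<mu>)"
proof -
  \<comment> \<open>Every stratum enters as a bundle of one chart. Only nonempty strata are listed,
    because a chart must have a nonempty domain.\<close>
  define \<C> where "\<C> = {{stratum_chart \<mu> i} | i. i > 0 \<and> sub_basic \<mu> (primitive_mats \<mu> i) \<noteq> {}}"
  have charts: "\<forall>B\<in>\<C>. bundled_chart (Sigma_top \<mu>) B"
  proof
    fix B assume "B \<in> \<C>"
    then obtain i where i: "B = {stratum_chart \<mu> i}" "simple_chart (Sigma_top \<mu>) (stratum_chart \<mu> i)"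
      using simple_chart_stratum[OF assms] by (auto simp: \<C>_def)
    then show "bundled_chart (Sigma_top \<mu>) B"
      by (simp add: bundled_chart_def bundle_dom_def simple_chart_def)
  qed
  have comparable: "\<forall>B\<in>\<C>. \<forall>C\<in>\<C>. analytic_comparable B C"
    using stratum_chart_dim_inject[OF assms]
    by (force simp: \<C>_def analytic_comparable_def intro: analytic_transition_refl)
  obtain \<M> where \<M>: "\<C> \<subseteq> \<M>" "\<forall>B\<in>\<M>. bundled_chart (Sigma_top \<mu>) B"
    "\<forall>B\<in>\<M>. \<forall>C\<in>\<M>. analytic_comparable B C"
    "\<And>V. bundled_chart (Sigma_top \<mu>) V \<Longrightarrow> \<forall>B\<in>\<M>. analytic_comparable V B \<Longrightarrow> V \<in> \<M>"
    by (rule exists_maximal_atlas[OF charts comparable]) blast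
  have "(\<Union>B\<in>\<M>. bundle_dom B) = topspace (Sigma_top \<mu>)"
  proof (intro subset_antisym subsetI)
    fix c assume "c \<in> (\<Union>B\<in>\<M>. bundle_dom B)"
    then show "c \<in> topspace (Sigma_top \<mu>)"
      using \<M>(2) openin_subset unfolding bundled_chart_def by blast
  next
    fix c assume "c \<in> topspace (Sigma_top \<mu>)"
    then have c: "c \<in> Sigma_mu \<mu>"
      by (simp add: topspace_Sigma_top)
    then obtain i A where i: "i > 0" "A \<in> primitive_mats \<mu> i" "A \<in> c"
      by (rule Sigma_mu_primitive_rep)
    then have ci: "c \<in> sub_basic \<mu> (primitive_mats \<mu> i)"
      using c by (auto simp: sub_basic_def)
    then have "{stratum_chart \<mu> i} \<in> \<M>"
      using i(1) \<M>(1) unfolding \<C>_def by blast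
    moreover have "c \<in> bundle_dom {stratum_chart \<mu> i}"
      using ci by (simp add: bundle_dom_def stratum_chart_def)
    ultimately show "c \<in> (\<Union>B\<in>\<M>. bundle_dom B)"
      by blast
  qed
  then show ?thesis
    unfolding bundled_analytic_manifold_def
    by (intro conjI exI[of _ \<M>] allI impI second_countable_Sigma_top Hausdorff_Sigma_top[OF assms]
        \<M>(2,3,4)) blast+
qed

end
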